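(* Let $\hat{\mathbf{A}}_0$ be the matrix with entries $\hat A_h((\phi_l,0),(\phi_m,0))$, $m,l\in I_0$. For all coefficient vectors $\mathbf{x}_0=(x_{0,j})_{j\in I_0}$ and corresponding $u_0=\sum_{j\in I_0}x_{0,j}\phi_j\in V_h$ the uniform equivalence $$\mathbf{x}_0^T\hat{\mathbf{A}}_0\mathbf{x}_0\sim\|\nabla u_0\|_\Omega^2$$ holds. Consequently, if $\mathbf{B}_0$ is a symmetric positive definite matrix with $\mathbf{x}_0^T\mathbf{B}_0\mathbf{x}_0\sim(\alpha\nabla u_0,\nabla u_0)_\Omega$ for all $\mathbf{x}_0$ (where $\alpha=\alpha_i$ on $\Omega_i$), then $\mathbf{B}_0$ is uniformly spectrally equivalent to $\hat{\mathbf{A}}_0$, i.e. $\mathbf{x}_0^T\mathbf{B}_0\mathbf{x}_0\sim\mathbf{x}_0^T\hat{\mathbf{A}}_0\mathbf{x}_0$ for all $\mathbf{x}_0$.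
   Context: Geometry and mesh. $d\in\{2,3\}$, $k\ge 1$; $\Omega\subset\mathbb{R}^d$ is a bounded connected polygonal domain with a non-overlapping partitioning into $\Omega_1,\Omega_2$, and $\Gamma=\overline{\Omega}_1\cap\overline{\Omega}_2$ is the (smooth) interface with unit normal $\mathbf{n}_\Gamma$ pointing from $\Omega_1$ into $\Omega_2$. $\{\mathcal{T}_h\}_{h>0}$ is a family of shape regular (not necessarily quasi-uniform) simplicial triangulations of $\Omega$, not fitted to $\Gamma$; $h_T$ is the diameter of $T\in\mathcal{T}_h$. $V_h$ is the space of continuous piecewise polynomials of degree $\le k$ on $\mathcal{T}_h$ vanishing on $\partial\Omega$. $\mathcal{T}_h^\Gamma$ is the set of simplices cut by $\Gamma$ and $\Omega_h^\Gamma$ is the domain they form; $\Omega_{i,h}^{\rm ex}$ is the domain formed by all simplices with nonzero intersection with $\Omega_i$. $V_{i,h}=\{(v_h)_{|\Omega_{i,h}^{\rm ex}}: v_h\in V_h\}$. Norms. $\|\cdot\|_\omega$ is the $L^2$ norm on $\omega$ and $(\cdot,\cdot)_\omega$ the $L^2$ scalar product. Scalings with $h$ are element-wise: $(h^{-1}u,v)_\Gamma=\sum_{T\in\mathcal{T}_h^\Gamma}h_T^{-1}(u,v)_{T\cap\Gamma}$, $\|h^{-1/2}v\|_\Gamma^2=(h^{-1}v,v)_\Gamma$. $A\sim B$ means $c_1B\le A\le c_2B$ with constants $c_1,c_2>0$ independent of $h$ and of the location of $\Gamma$ in the triangulation (they may depend on shape regularity, $d$, $k$, the smoothness of $\Gamma$,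 $\alpha_1,\alpha_2$, $\gamma$, $\beta$). Spaces. $\phi_j$, $j\in I_0$, are the nodal basis functions of $V_h$. $I^\Gamma\subset I_0$ are the labels of nodes in $\Omega_h^\Gamma$, $I_i^\Gamma=\{j\in I^\Gamma:\text{node } j\text{ is not in }\Omega_i\}$, $i=1,2$. It is assumed that no nodes lie on $\Gamma$; then $I^\Gamma=I_1^\Gamma\cup I_2^\Gamma$ is a disjoint partition. Cut basis functions: $\phi_j^\Gamma=\phi_j|_{\Omega_h^\Gamma}$, $j\in I^\Gamma$. $V_i^\Gamma=\mathrm{span}\{\phi_j^\Gamma: j\in I_i^\Gamma\}$ and $V_h^\Gamma=V_1^\Gamma\oplus V_2^\Gamma$; $Q_i:V_h^\Gamma\to V_i^\Gamma$, $Q_i\big(\sum_{j\in I^\Gamma}\beta_j\phi_j^\Gamma\big)=\sum_{j\in I_i^\Gamma}\beta_j\phi_j^\Gamma$. Functions in $V_i^\Gamma$ are extended by zero to $\Omega_{i,h}^{\rm ex}$. The isomorphism $L:V_h\times V_h^\Gamma\to V_{1,h}\times V_{2,h}$ is $L(u_0,u^\Gamma)=(u_{1,h},u_{2,h})$ with $u_{i,h}={u_0}_{|\Omega_{i,h}^{\rm ex}}+Q_iu^\Gamma$. Bilinear forms. $\alpha_1,\alpha_2>0$ are the diffusion coefficients, $\gamma,\beta>0$ fixed parameters, $[\![\cdot]\!]$ the jump across $\Gamma$ (resp. across a face), $[\![u_h]\!]=(u_{1,h}-u_{2,h})_{|\Gamma}$, $\{\!\!\{\cdot\}\!\!\}$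 a weighted averaging operator across $\Gamma$, $\bar\alpha$ a corresponding average of $\alpha_1,\alpha_2$, and $\mathcal{F}_{g,i}$ a suitable subset of faces in $\Omega_h^\Gamma$ with face diameters $h_F$. For $u_h,v_h\in V_{1,h}\times V_{2,h}$: $$A_h(u_h,v_h)=\sum_{i=1}^2(\alpha_i\nabla u_{i,h},\nabla v_{i,h})_{\Omega_i}+N_h^c(u_h,v_h)+N_h^c(v_h,u_h)+\bar\alpha\gamma(h^{-1}[\![u_h]\!],[\![v_h]\!])_\Gamma+G_h(u_h,v_h),$$ $$N_h^c(u_h,v_h)=(\{\!\!\{-\alpha\nabla v_h\}\!\!\}\cdot\mathbf{n}_\Gamma,[\![u_h]\!])_\Gamma,\quad G_h(u_h,v_h)=\beta\sum_{i=1}^2\sum_{\ell=1}^k\sum_{F\in\mathcal{F}_{g,i}}h_F^{2\ell-1}([\![\partial_n^\ell u_{i,h}]\!],[\![\partial_n^\ell v_{i,h}]\!])_F .$$ Set $\hat A_h(\hat u_h,\hat v_h)=A_h(L\hat u_h,L\hat v_h)$ on $V_h\times V_h^\Gamma$. The averaging, $\gamma$, $\beta$ and $\mathcal{F}_{g,i}$ are such that the following norm equivalence, known from the CutFEM literature, holds: $\hat A_h(\hat u_h,\hat u_h)\sim\sum_{i=1}^2\|\nabla u_{i,h}\|_{\Omega_{i,h}^{\rm ex}}^2+\|h^{-1/2}(u_{1,h}-u_{2,h})\|_\Gamma^2$ for all $\hat u_h\in V_h\times V_h^\Gamma$. *)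

theory Defs
  imports "HOL-Analysis.Analysis"
begin

section \<open>Uniform equivalence\<close>

text \<open>
  \<open>A \<sim> B\<close>, with constants that do not depend on the element of \<open>S\<close>. In use, the elements of \<open>S\<close>
  are tuples whose first component selects a member of a family of configurations
  (mesh and position of the interface), so the constants are uniform in the family.
\<close>

definition unif_equiv :: "'p set \<Rightarrow> ('p \<Rightarrow> real) \<Rightarrow> ('p \<Rightarrow> real) \<Rightarrow> bool" where
  "unif_equiv S A B \<longleftrightarrow>
     (\<exists>c1 c2. c1 > 0 \<and> c2 > 0 \<and> (\<forall>p\<in>S. c1 * B p \<le> A p \<and> A p \<le> c2 * B p))"

section \<open>Surface measure\<close>

definition hausdorff_pre :: "nat \<Rightarrow> real \<Rightarrow> 'a::euclidean_space set \<Rightarrow> ennreal" where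
  "hausdorff_pre m \<delta> A =
     (INF C \<in> {C :: nat \<Rightarrow> 'a set. A \<subseteq> (\<Union>n. C n) \<and> (\<forall>n. bounded (C n) \<and> diameter (C n) \<le> \<delta>)}.
        \<Sum>n. ennreal (unit_ball_vol (real m) * (diameter (C n) / 2) ^ m))"

text \<open>
  The Hausdorff outer measure of codimension one, normalised to agree with surface area.
  It is a metric outer measure, hence (Caratheodory) countably additive on the Borel sets.
\<close>

definition surface_measure :: "'a::euclidean_space measure" where
  "surface_measure =
     measure_of UNIV (sets borel) (\<lambda>A. SUP \<delta>\<in>{0<..}. hausdorff_pre (DIM('a) - 1) \<delta> A)"

section \<open>Gradients, smooth functions, polynomials\<close>

text \<open>
  The gradient of \<open>u\<close> at \<open>x\<close>, taken relative to \<open>S\<close>. For \<open>x\<close> in the interior of \<open>S\<close> it is the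
  ordinary gradient; on a smooth part of the boundary of \<open>S\<close> it is the trace from \<open>S\<close>.
\<close>

definition grad_on :: "'a::euclidean_space set \<Rightarrow> ('a \<Rightarrow> real) \<Rightarrow> 'a \<Rightarrow> 'a" where
  "grad_on S u x = (\<Sum>b\<in>Basis. frechet_derivative u (at x within S) b *\<^sub>R b)"

definition grad_ip :: "'a::euclidean_space set \<Rightarrow> ('a \<Rightarrow> real) \<Rightarrow> ('a \<Rightarrow> real) \<Rightarrow> real" where
  "grad_ip S u v = (LINT x:S|lebesgue. grad_on S u x \<bullet> grad_on S v x)"

primrec C_on :: "nat \<Rightarrow> 'a::euclidean_space set \<Rightarrow> ('a \<Rightarrow> real) \<Rightarrow> bool" where
  "C_on 0 U f \<longleftrightarrow> continuous_on U f"
| "C_on (Suc m) U f \<longleftrightarrow>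
     f differentiable_on U \<and> (\<forall>b\<in>Basis. C_on m U (\<lambda>x. frechet_derivative f (at x) b))"

definition smooth_fun_on :: "'a::euclidean_space set \<Rightarrow> ('a \<Rightarrow> real) \<Rightarrow> bool" where
  "smooth_fun_on U f \<longleftrightarrow> (\<forall>m. C_on m U f)"

definition poly_fun :: "nat \<Rightarrow> ('a::euclidean_space \<Rightarrow> real) \<Rightarrow> bool" where
  "poly_fun k p \<longleftrightarrow>
     (\<exists>c. p = (\<lambda>x. \<Sum>e\<in>{e \<in> Basis \<rightarrow>\<^sub>E {..k}. sum e Basis \<le> k}. c e * (\<Prod>b\<in>Basis. (x \<bullet> b) ^ e b)))"

definition restr0 :: "'a set \<Rightarrow> ('a \<Rightarrow> real) \<Rightarrow> 'a \<Rightarrow> real" where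
  "restr0 S u = (\<lambda>x. if x \<in> S then u x else 0)"

section \<open>Domain, mesh and interface\<close>

definition polygonal_domain :: "'a::euclidean_space set \<Rightarrow> bool" where
  "polygonal_domain \<Omega> \<longleftrightarrow>
     \<Omega> \<noteq> {} \<and> connected \<Omega> \<and>
     (\<exists>\<P>. finite \<P> \<and> (\<forall>K\<in>\<P>. polytope K) \<and> \<Omega> = interior (\<Union>\<P>))"

text \<open>
  The data of one configuration: the two subdomains \<open>subdom M 1\<close> and \<open>subdom M 2\<close>, the unit normal
  on their interface, the simplices of the mesh, the nodal basis functions (labelled by the nodes
  themselves), the averaging weights, and the two sets of faces in the ghost penalty.
\<close>

record 'a cut_config =
  subdom :: "nat \<Rightarrow> 'a set"
  nrm    :: "'a \<Rightarrow> 'a"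
  mesh   :: "'a set set"
  hat    :: "'a \<Rightarrow> 'a \<Rightarrow> real"
  weight :: "nat \<Rightarrow> 'a \<Rightarrow> real"
  ghost  :: "nat \<Rightarrow> 'a set set"

definition mesh_of :: "'a::euclidean_space set \<Rightarrow> 'a set set \<Rightarrow> bool" where
  "mesh_of \<Omega> \<T> \<longleftrightarrow>
     triangulation \<T> \<and> (\<forall>T\<in>\<T>. int DIM('a) simplex T) \<and> \<Union>\<T> = closure \<Omega>"

definition shape_regular :: "real \<Rightarrow> 'a::euclidean_space set set \<Rightarrow> bool" where
  "shape_regular \<sigma> \<T> \<longleftrightarrow> (\<forall>T\<in>\<T>. \<exists>x. cball x (diameter T / \<sigma>) \<subseteq> T)"

definition interface :: "('a::euclidean_space, 'm) cut_config_scheme \<Rightarrow> 'a set" where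
  "interface M = closure (subdom M 1) \<inter> closure (subdom M 2)"

definition partition_of :: "'a::euclidean_space set \<Rightarrow> ('a, 'm) cut_config_scheme \<Rightarrow> bool" where
  "partition_of \<Omega> M \<longleftrightarrow>
     (\<forall>i\<in>{1, 2}. open (subdom M i) \<and> subdom M i \<noteq> {}) \<and>
     subdom M 1 \<inter> subdom M 2 = {} \<and>
     \<Omega> = subdom M 1 \<union> subdom M 2 \<union> (interface M \<inter> \<Omega>)"

text \<open>
  The interface is locally the zero set, within the domain, of a smooth level set function that is
  negative in the first and positive in the second subdomain; \<open>nrm\<close> is its normalised gradient.
  The interface is allowed to reach the boundary of the domain.
\<close>

definition smooth_interface :: "'a::euclidean_space set \<Rightarrow> ('a, 'm) cut_config_scheme \<Rightarrow> bool" where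
  "smooth_interface \<Omega> M \<longleftrightarrow>
     (\<forall>x\<in>interface M. \<exists>U \<psi>. open U \<and> x \<in> U \<and> smooth_fun_on U \<psi> \<and>
        (\<forall>y\<in>U. grad_on U \<psi> y \<noteq> 0) \<and>
        subdom M 1 \<inter> U = {y \<in> \<Omega> \<inter> U. \<psi> y < 0} \<and>
        subdom M 2 \<inter> U = {y \<in> \<Omega> \<inter> U. \<psi> y > 0} \<and>
        (\<forall>y\<in>interface M \<inter> U. nrm M y = sgn (grad_on U \<psi> y)))"

text \<open>
  A simplex is cut if the interface passes through its interior, equivalently if it meets both
  subdomains. A simplex merely touched by the interface lies in the closure of one subdomain.
\<close>

definition cut_simplices :: "('a::euclidean_space, 'm) cut_config_scheme \<Rightarrow> 'a set set" where
  "cut_simplices M = {T \<in> mesh M. interior T \<inter> interface M \<noteq> {}}"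

definition cut_region :: "('a::euclidean_space, 'm) cut_config_scheme \<Rightarrow> 'a set" where
  "cut_region M = \<Union>(cut_simplices M)"

definition ext_region :: "('a::euclidean_space, 'm) cut_config_scheme \<Rightarrow> nat \<Rightarrow> 'a set" where
  "ext_region M i = \<Union>{T \<in> mesh M. T \<inter> subdom M i \<noteq> {}}"

section \<open>Finite element spaces\<close>

text \<open>
  Functions vanishing on the boundary of the domain are extended by zero to the whole space, so
  that a finite element function is determined by its values on the domain.
\<close>

definition Vh :: "nat \<Rightarrow> 'a::euclidean_space set \<Rightarrow> ('a, 'm) cut_config_scheme \<Rightarrow> ('a \<Rightarrow> real) set" where
  "Vh k \<Omega> M = {v. continuous_on (closure \<Omega>) v \<and> (\<forall>x. x \<notin> \<Omega> \<longrightarrow> v x = 0) \<and>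
                  (\<forall>T\<in>mesh M. \<exists>p. poly_fun k p \<and> (\<forall>x\<in>T. v x = p x))}"

text \<open>The points of a simplex whose barycentric coordinates are integer multiples of \<open>1/k\<close>.\<close>

definition lagrange_nodes :: "nat \<Rightarrow> 'a::euclidean_space set \<Rightarrow> 'a set" where
  "lagrange_nodes k T =
     (let C = {v. v extreme_point_of T}
      in {\<Sum>v\<in>C. (real (a v) / real k) *\<^sub>R v | a. sum a C = k})"

definition I0 :: "nat \<Rightarrow> 'a::euclidean_space set \<Rightarrow> ('a, 'm) cut_config_scheme \<Rightarrow> 'a set" where
  "I0 k \<Omega> M = (\<Union>T\<in>mesh M. lagrange_nodes k T) \<inter> \<Omega>"

definition nodal_basis :: "nat \<Rightarrow> 'a::euclidean_space set \<Rightarrow> ('a, 'm) cut_config_scheme \<Rightarrow> bool" where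
  "nodal_basis k \<Omega> M \<longleftrightarrow>
     (\<forall>j\<in>I0 k \<Omega> M. hat M j \<in> Vh k \<Omega> M \<and> (\<forall>i\<in>I0 k \<Omega> M. hat M j i = (if i = j then 1 else 0)))"

definition fe_fun :: "nat \<Rightarrow> 'a::euclidean_space set \<Rightarrow> ('a, 'm) cut_config_scheme \<Rightarrow>
    ('a \<Rightarrow> real) \<Rightarrow> 'a \<Rightarrow> real" where
  "fe_fun k \<Omega> M x = (\<lambda>y. \<Sum>j\<in>I0 k \<Omega> M. x j * hat M j y)"

definition Icut :: "nat \<Rightarrow> 'a::euclidean_space set \<Rightarrow> ('a, 'm) cut_config_scheme \<Rightarrow> 'a set" where
  "Icut k \<Omega> M = I0 k \<Omega> M \<inter> cut_region M"

definition Icut_i :: "nat \<Rightarrow> 'a::euclidean_space set \<Rightarrow> ('a, 'm) cut_config_scheme \<Rightarrow> nat \<Rightarrow> 'a set" where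
  "Icut_i k \<Omega> M i = {j \<in> Icut k \<Omega> M. j \<notin> subdom M i}"

text \<open>Functions on the cut region are extended by zero.\<close>

definition cut_hat :: "('a::euclidean_space, 'm) cut_config_scheme \<Rightarrow> 'a \<Rightarrow> 'a \<Rightarrow> real" where
  "cut_hat M j = restr0 (cut_region M) (hat M j)"

definition cut_comb :: "('a::euclidean_space, 'm) cut_config_scheme \<Rightarrow> 'a set \<Rightarrow>
    ('a \<Rightarrow> real) \<Rightarrow> 'a \<Rightarrow> real" where
  "cut_comb M J b = (\<lambda>x. \<Sum>j\<in>J. b j * cut_hat M j x)"

definition Vcut_i :: "nat \<Rightarrow> 'a::euclidean_space set \<Rightarrow> ('a, 'm) cut_config_scheme \<Rightarrow> nat \<Rightarrow>
    ('a \<Rightarrow> real) set" where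
  "Vcut_i k \<Omega> M i = range (cut_comb M (Icut_i k \<Omega> M i))"

definition Vcut :: "nat \<Rightarrow> 'a::euclidean_space set \<Rightarrow> ('a, 'm) cut_config_scheme \<Rightarrow> ('a \<Rightarrow> real) set" where
  "Vcut k \<Omega> M = {\<lambda>x. v1 x + v2 x | v1 v2. v1 \<in> Vcut_i k \<Omega> M 1 \<and> v2 \<in> Vcut_i k \<Omega> M 2}"

text \<open>The coefficients below are unique, since a cut basis function is a Kronecker delta on nodes.\<close>

definition Qcut :: "nat \<Rightarrow> 'a::euclidean_space set \<Rightarrow> ('a, 'm) cut_config_scheme \<Rightarrow> nat \<Rightarrow>
    ('a \<Rightarrow> real) \<Rightarrow> 'a \<Rightarrow> real" where
  "Qcut k \<Omega> M i w = cut_comb M (Icut_i k \<Omega> M i) (SOME b. w = cut_comb M (Icut k \<Omega> M) b)"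

text \<open>
  A pair of functions on the two extended regions is a function of the index \<open>i \<in> {1, 2}\<close>;
  the \<open>i\<close>-th component is zero outside \<open>ext_region M i\<close>.
\<close>

definition Lmap :: "nat \<Rightarrow> 'a::euclidean_space set \<Rightarrow> ('a, 'm) cut_config_scheme \<Rightarrow>
    ('a \<Rightarrow> real) \<times> ('a \<Rightarrow> real) \<Rightarrow> nat \<Rightarrow> 'a \<Rightarrow> real" where
  "Lmap k \<Omega> M uw = (\<lambda>i x. restr0 (ext_region M i) (fst uw) x + Qcut k \<Omega> M i (snd uw) x)"

section \<open>The Nitsche--CutFEM bilinear form\<close>

definition averaging_weights :: "('a::euclidean_space, 'm) cut_config_scheme \<Rightarrow> bool" where
  "averaging_weights M \<longleftrightarrow>
     (\<forall>i\<in>{1, 2}. weight M i \<in> borel_measurable borel \<and> (\<forall>x\<in>interface M. weight M i x \<ge> 0)) \<and>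
     (\<forall>x\<in>interface M. weight M 1 x + weight M 2 x = 1)"

text \<open>
  Penalised faces lie in the cut region, and both adjacent simplices belong to the extended
  region on which the corresponding component is defined.
\<close>

definition ghost_faces :: "('a::euclidean_space, 'm) cut_config_scheme \<Rightarrow> bool" where
  "ghost_faces M \<longleftrightarrow>
     (\<forall>i\<in>{1, 2}. \<forall>F\<in>ghost M i. F \<subseteq> cut_region M \<and>
        (\<exists>T\<in>mesh M. \<exists>T'\<in>mesh M. T \<noteq> T' \<and> F facet_of T \<and> F facet_of T' \<and>
           T \<inter> subdom M i \<noteq> {} \<and> T' \<inter> subdom M i \<noteq> {}))"

definition jump :: "(nat \<Rightarrow> 'a \<Rightarrow> real) \<Rightarrow> 'a \<Rightarrow> real" where
  "jump u = (\<lambda>x. u 1 x - u 2 x)"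

definition hinv_ip :: "('a::euclidean_space, 'm) cut_config_scheme \<Rightarrow> ('a \<Rightarrow> real) \<Rightarrow> ('a \<Rightarrow> real) \<Rightarrow> real" where
  "hinv_ip M u v = (\<Sum>T\<in>cut_simplices M.
     (1 / diameter T) * (LINT x:(T \<inter> interface M)|surface_measure. u x * v x))"

definition Nc :: "(nat \<Rightarrow> real) \<Rightarrow> ('a::euclidean_space, 'm) cut_config_scheme \<Rightarrow>
    (nat \<Rightarrow> 'a \<Rightarrow> real) \<Rightarrow> (nat \<Rightarrow> 'a \<Rightarrow> real) \<Rightarrow> real" where
  "Nc \<alpha> M u v = (LINT x:interface M|surface_measure.
     ((\<Sum>i\<in>{1, 2}. weight M i x *\<^sub>R (- (\<alpha> i *\<^sub>R grad_on (subdom M i) (v i) x))) \<bullet> nrm M x) * jump u x)"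

definition poly_piece :: "nat \<Rightarrow> 'a::euclidean_space set \<Rightarrow> ('a \<Rightarrow> real) \<Rightarrow> 'a \<Rightarrow> real" where
  "poly_piece k T u = (SOME p. poly_fun k p \<and> (\<forall>x\<in>T. u x = p x))"

definition dir_deriv :: "nat \<Rightarrow> 'a::euclidean_space \<Rightarrow> ('a \<Rightarrow> real) \<Rightarrow> 'a \<Rightarrow> real" where
  "dir_deriv l n p x = (deriv ^^ l) (\<lambda>t::real. p (x + t *\<^sub>R n)) 0"

text \<open>
  The order of the two neighbours of a face and the sign of its normal are arbitrary; they do not
  affect products of two jumps.
\<close>

definition face_sides :: "('a::euclidean_space, 'm) cut_config_scheme \<Rightarrow> 'a set \<Rightarrow> 'a set \<times> 'a set" where
  "face_sides M F = (SOME (T, T'). T \<in> mesh M \<and> T' \<in> mesh M \<and> T \<noteq> T' \<and> F facet_of T \<and> F facet_of T')"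

definition face_normal :: "'a::euclidean_space set \<Rightarrow> 'a" where
  "face_normal F = (SOME n. norm n = 1 \<and> (\<forall>x\<in>F. \<forall>y\<in>F. n \<bullet> (x - y) = 0))"

definition face_jump :: "nat \<Rightarrow> ('a::euclidean_space, 'm) cut_config_scheme \<Rightarrow> nat \<Rightarrow> 'a set \<Rightarrow>
    ('a \<Rightarrow> real) \<Rightarrow> 'a \<Rightarrow> real" where
  "face_jump k M l F u x =
     dir_deriv l (face_normal F) (poly_piece k (fst (face_sides M F)) u) x -
     dir_deriv l (face_normal F) (poly_piece k (snd (face_sides M F)) u) x"

definition Gh :: "nat \<Rightarrow> real \<Rightarrow> ('a::euclidean_space, 'm) cut_config_scheme \<Rightarrow>
    (nat \<Rightarrow> 'a \<Rightarrow> real) \<Rightarrow> (nat \<Rightarrow> 'a \<Rightarrow> real) \<Rightarrow> real" where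
  "Gh k \<beta> M u v = \<beta> * (\<Sum>i\<in>{1, 2}. \<Sum>l=1..k. \<Sum>F\<in>ghost M i. diameter F ^ (2 * l - 1) *
     (LINT x:F|surface_measure. face_jump k M l F (u i) x * face_jump k M l F (v i) x))"

definition Ah :: "nat \<Rightarrow> (nat \<Rightarrow> real) \<Rightarrow> real \<Rightarrow> real \<Rightarrow> real \<Rightarrow> ('a::euclidean_space, 'm) cut_config_scheme \<Rightarrow>
    (nat \<Rightarrow> 'a \<Rightarrow> real) \<Rightarrow> (nat \<Rightarrow> 'a \<Rightarrow> real) \<Rightarrow> real" where
  "Ah k \<alpha> \<alpha>bar \<gamma> \<beta> M u v =
     (\<Sum>i\<in>{1, 2}. \<alpha> i * grad_ip (subdom M i) (u i) (v i)) + Nc \<alpha> M u v + Nc \<alpha> M v u +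
     \<alpha>bar * \<gamma> * hinv_ip M (jump u) (jump v) + Gh k \<beta> M u v"

definition Ahat :: "nat \<Rightarrow> 'a::euclidean_space set \<Rightarrow> (nat \<Rightarrow> real) \<Rightarrow> real \<Rightarrow> real \<Rightarrow> real \<Rightarrow>
    ('a, 'm) cut_config_scheme \<Rightarrow>
    ('a \<Rightarrow> real) \<times> ('a \<Rightarrow> real) \<Rightarrow> ('a \<Rightarrow> real) \<times> ('a \<Rightarrow> real) \<Rightarrow> real" where
  "Ahat k \<Omega> \<alpha> \<alpha>bar \<gamma> \<beta> M u v = Ah k \<alpha> \<alpha>bar \<gamma> \<beta> M (Lmap k \<Omega> M u) (Lmap k \<Omega> M v)"

definition energy :: "nat \<Rightarrow> 'a::euclidean_space set \<Rightarrow> ('a, 'm) cut_config_scheme \<Rightarrow>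
    ('a \<Rightarrow> real) \<times> ('a \<Rightarrow> real) \<Rightarrow> real" where
  "energy k \<Omega> M uw = (let u = Lmap k \<Omega> M uw in
     (\<Sum>i\<in>{1, 2}. grad_ip (ext_region M i) (u i) (u i)) + hinv_ip M (jump u) (jump u))"

text \<open>The value of the diffusion coefficient on the interface, a null set, is immaterial.\<close>

definition diffusion_ip :: "'a::euclidean_space set \<Rightarrow> (nat \<Rightarrow> real) \<Rightarrow> ('a, 'm) cut_config_scheme \<Rightarrow>
    ('a \<Rightarrow> real) \<Rightarrow> ('a \<Rightarrow> real) \<Rightarrow> real" where
  "diffusion_ip \<Omega> \<alpha> M u v = (LINT x:\<Omega>|lebesgue.
     (if x \<in> subdom M 1 then \<alpha> 1 else \<alpha> 2) * (grad_on \<Omega> u x \<bullet> grad_on \<Omega> v x))"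

section \<open>Matrices indexed by nodes\<close>

definition quad_form :: "'j set \<Rightarrow> ('j \<Rightarrow> 'j \<Rightarrow> real) \<Rightarrow> ('j \<Rightarrow> real) \<Rightarrow> real" where
  "quad_form J B x = (\<Sum>m\<in>J. \<Sum>l\<in>J. x m * B m l * x l)"

definition spd :: "'j set \<Rightarrow> ('j \<Rightarrow> 'j \<Rightarrow> real) \<Rightarrow> bool" where
  "spd J B \<longleftrightarrow> (\<forall>m\<in>J. \<forall>l\<in>J. B m l = B l m) \<and>
     (\<forall>x. (\<exists>j\<in>J. x j \<noteq> 0) \<longrightarrow> quad_form J B x > 0)"

definition A0 :: "nat \<Rightarrow> 'a::euclidean_space set \<Rightarrow> (nat \<Rightarrow> real) \<Rightarrow> real \<Rightarrow> real \<Rightarrow> real \<Rightarrow>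
    ('a, 'm) cut_config_scheme \<Rightarrow> 'a \<Rightarrow> 'a \<Rightarrow> real" where
  "A0 k \<Omega> \<alpha> \<alpha>bar \<gamma> \<beta> M m l = Ahat k \<Omega> \<alpha> \<alpha>bar \<gamma> \<beta> M (hat M l, \<lambda>_. 0) (hat M m, \<lambda>_. 0)"

end

theory Submission
  imports Defs
begin

text \<open>
  For a pair \<open>(u, 0)\<close> both components of its image under the isomorphism are restrictions of \<open>u\<close>,
  so the jump across the interface vanishes, and with it the consistency and penalty terms. The energy
  is then the sum of the squared gradient norms over the two extended regions, which cover the domain
  and overlap at most twice, so it lies between one and two times the squared gradient norm on the
  domain. It remains to see that the quadratic form of the matrix is \<open>A((u, 0), (u, 0))\<close>, i.e. that
  the form is bilinear in spite of the integrals and choices in its definition: gradients are linear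
  off the skeleton of the mesh, which is a null set; a facet belongs to at most two simplices, so the
  ghost penalty sees polynomial pieces of \<open>u\<close>; and facets have finite surface measure, so products of
  jumps are integrable.
\<close>

section \<open>Polynomials and their directional derivatives\<close>

text \<open>The obstacle is that total functions hide default values:
  \<open>frechet_derivative\<close>, \<open>poly_piece\<close> and \<open>face_sides\<close> are
  choices, and the Bochner integral of a non-integrable function is 0. Linearity of a term therefore
  has to be earned by differentiability, by uniqueness of the chosen object, and by integrability.
  Volume integrals are all brought to one integrand \<open>gdot\<close> on \<open>core\<close>. The
  choice in \<open>face_sides\<close> does not mention the subdomains; the bound of two simplices
  per facet is what places the chosen neighbours inside the extended region, where the truncation
  \<open>restr0\<close> is invisible. Linearity is established only for pairs (u, 0) with u in V_h,
  and nodal expansions stay there. The constants are those of the assumed norm equivalence, then 1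
  and 2, then the smaller and the larger diffusion coefficient; each is fixed before the
  configuration, which is the uniformity. The claim on \<open>B\<close> compares diffusion form and
  matrix through the common quantity \<open>grad_ip \<Omega>\<close>.\<close>

definition cont_coeffs :: "('a::topological_space \<Rightarrow> real poly) \<Rightarrow> bool" where
  "cont_coeffs q \<longleftrightarrow> (\<forall>i. continuous_on UNIV (\<lambda>x. coeff (q x) i))"

lemma cont_coeffs_mult:
  "cont_coeffs q \<Longrightarrow> cont_coeffs r \<Longrightarrow> cont_coeffs (\<lambda>x. q x * r x)"
  unfolding cont_coeffs_def coeff_mult by (intro allI continuous_intros) auto

lemma cont_coeffs_const: "cont_coeffs (\<lambda>_. q)"
  by (simp add: cont_coeffs_def)

lemma cont_coeffs_power: "cont_coeffs q \<Longrightarrow> cont_coeffs (\<lambda>x. q x ^ n)"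
  by (induction n) (auto intro: cont_coeffs_mult cont_coeffs_const)

lemma cont_coeffs_prod:
  "(\<And>i. i \<in> A \<Longrightarrow> cont_coeffs (q i)) \<Longrightarrow> cont_coeffs (\<lambda>x. \<Prod>i\<in>A. q i x)"
  by (induction A rule: infinite_finite_induct) (auto intro: cont_coeffs_mult cont_coeffs_const)

lemma cont_coeffs_sum:
  "(\<And>i. i \<in> A \<Longrightarrow> cont_coeffs (q i)) \<Longrightarrow> cont_coeffs (\<lambda>x. \<Sum>i\<in>A. q i x)"
  by (auto simp: cont_coeffs_def coeff_sum intro!: continuous_intros)

lemma cont_coeffs_smult: "cont_coeffs q \<Longrightarrow> cont_coeffs (\<lambda>x. smult c (q x))"
  by (auto simp: cont_coeffs_def intro!: continuous_intros)

lemma cont_coeffs_affine: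
  fixes f g :: "'a::topological_space \<Rightarrow> real"
  assumes "continuous_on UNIV f" "continuous_on UNIV g"
  shows "cont_coeffs (\<lambda>x. [:f x, g x:])"
  unfolding cont_coeffs_def
proof
  fix i show "continuous_on UNIV (\<lambda>x. coeff [:f x, g x:] i)"
    using assms by (cases i; cases "i - 1") (simp_all add: coeff_pCons)
qed

lemma cont_coeffs_pderiv: "cont_coeffs q \<Longrightarrow> cont_coeffs (\<lambda>x. pderiv (q x))"
  by (auto simp: cont_coeffs_def coeff_pderiv intro!: continuous_intros)

lemma cont_coeffs_pderiv_funpow: "cont_coeffs q \<Longrightarrow> cont_coeffs (\<lambda>x. (pderiv ^^ l) (q x))"
  by (induction l) (auto intro: cont_coeffs_pderiv)

text \<open>Along a line with direction \<open>n\<close> each coordinate is affine in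
  \<open>t\<close>, so \<open>p\<close> becomes a univariate polynomial, and a directional
  derivative at \<open>x\<close> is a single coefficient. Continuity in the base point is stated
  coefficient by coefficient because the degree of \<open>q x\<close> may change with
  \<open>x\<close>.\<close>

lemma poly_fun_on_lineE:
  fixes n :: "'a::euclidean_space"
  assumes "poly_fun k p"
  obtains q where "\<And>x t. p (x + t *\<^sub>R n) = poly (q x) t" "cont_coeffs q"
proof -
  obtain c where p: "p = (\<lambda>x. \<Sum>e\<in>{e \<in> Basis \<rightarrow>\<^sub>E {..k}. sum e Basis \<le> k}. c e * (\<Prod>b\<in>Basis. (x \<bullet> b) ^ e b))"
    using assms unfolding poly_fun_def by auto
  let ?q = "\<lambda>x. \<Sum>e\<in>{e \<in> Basis \<rightarrow>\<^sub>E {..k}. sum e Basis \<le> k}.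
    smult (c e) (\<Prod>b\<in>Basis. [:x \<bullet> b, n \<bullet> b:] ^ e b)"
  have "p (x + t *\<^sub>R n) = poly (?q x) t" for x t
    by (simp add: p poly_sum poly_prod inner_add_left)
  moreover have "cont_coeffs ?q"
    by (intro cont_coeffs_sum cont_coeffs_smult cont_coeffs_prod cont_coeffs_power
          cont_coeffs_affine continuous_intros)
  ultimately show ?thesis by (rule that)
qed

lemma deriv_poly: "deriv (poly q) = poly (pderiv q)" for q :: "real poly"
  by (rule ext) (rule DERIV_imp_deriv, rule poly_DERIV)

lemma higher_deriv_poly: "(deriv ^^ l) (poly q) = poly ((pderiv ^^ l) q)" for q :: "real poly"
  by (induction l) (simp_all add: deriv_poly)

lemma dir_deriv_on_line:
  assumes "\<And>x t. p (x + t *\<^sub>R n) = poly (q x) t"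
  shows "dir_deriv l n p x = coeff ((pderiv ^^ l) (q x)) 0"
  unfolding dir_deriv_def assms by (simp add: higher_deriv_poly poly_0_coeff_0)

lemma continuous_on_dir_deriv:
  assumes "poly_fun k p"
  shows "continuous_on UNIV (dir_deriv l n p)"
proof -
  obtain q where q: "\<And>x t. p (x + t *\<^sub>R n) = poly (q x) t" "cont_coeffs q"
    using poly_fun_on_lineE[OF assms] by metis
  have "dir_deriv l n p = (\<lambda>x. coeff ((pderiv ^^ l) (q x)) 0)"
    using dir_deriv_on_line[of p n q, OF q(1)] by auto
  then show ?thesis
    using cont_coeffs_pderiv_funpow[OF q(2), of l] by (simp add: cont_coeffs_def)
qed

lemma pderiv_funpow_add: "(pderiv ^^ l) (q + r) = (pderiv ^^ l) q + (pderiv ^^ l) r"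
  for q r :: "real poly"
  by (induction l) (simp_all add: pderiv_add)

lemma pderiv_funpow_smult: "(pderiv ^^ l) (smult c q) = smult c ((pderiv ^^ l) q)"
  for q :: "real poly"
  by (induction l) (simp_all add: pderiv_smult)

lemma dir_deriv_add:
  assumes "poly_fun k p" "poly_fun k r"
  shows "dir_deriv l n (\<lambda>x. p x + r x) x = dir_deriv l n p x + dir_deriv l n r x"
proof -
  obtain q where q: "\<And>x t. p (x + t *\<^sub>R n) = poly (q x) t"
    using poly_fun_on_lineE[OF assms(1)] by metis
  obtain s where s: "\<And>x t. r (x + t *\<^sub>R n) = poly (s x) t"
    using poly_fun_on_lineE[OF assms(2)] by metis
  have "dir_deriv l n (\<lambda>x. p x + r x) x = coeff ((pderiv ^^ l) (q x + s x)) 0"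
    by (rule dir_deriv_on_line) (simp add: q s)
  then show ?thesis
    by (simp add: dir_deriv_on_line[of p n q, OF q] dir_deriv_on_line[of r n s, OF s] pderiv_funpow_add)
qed

lemma dir_deriv_scale:
  assumes "poly_fun k p"
  shows "dir_deriv l n (\<lambda>x. c * p x) x = c * dir_deriv l n p x"
proof -
  obtain q where q: "\<And>x t. p (x + t *\<^sub>R n) = poly (q x) t"
    using poly_fun_on_lineE[OF assms(1)] by metis
  have "dir_deriv l n (\<lambda>x. c * p x) x = coeff ((pderiv ^^ l) (smult c (q x))) 0"
    by (rule dir_deriv_on_line) (simp add: q)
  then show ?thesis
    by (simp add: dir_deriv_on_line[of p n q, OF q] pderiv_funpow_smult)
qed

lemma poly_fun_add:
  assumes "poly_fun k p" "poly_fun k r"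
  shows "poly_fun k (\<lambda>x. p x + r x)"
proof -
  obtain c where c: "p = (\<lambda>x. \<Sum>e\<in>{e \<in> Basis \<rightarrow>\<^sub>E {..k}. sum e Basis \<le> k}. c e * (\<Prod>b\<in>Basis. (x \<bullet> b) ^ e b))"
    using assms unfolding poly_fun_def by auto
  obtain d where d: "r = (\<lambda>x. \<Sum>e\<in>{e \<in> Basis \<rightarrow>\<^sub>E {..k}. sum e Basis \<le> k}. d e * (\<Prod>b\<in>Basis. (x \<bullet> b) ^ e b))"
    using assms unfolding poly_fun_def by auto
  show ?thesis
    unfolding poly_fun_def c d
    by (rule exI[of _ "\<lambda>e. c e + d e"]) (simp add: sum.distrib distrib_right)
qed

lemma poly_fun_scale:
  assumes "poly_fun k p"
  shows "poly_fun k (\<lambda>x. a * p x)"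
proof -
  obtain c where c: "p = (\<lambda>x. \<Sum>e\<in>{e \<in> Basis \<rightarrow>\<^sub>E {..k}. sum e Basis \<le> k}. c e * (\<Prod>b\<in>Basis. (x \<bullet> b) ^ e b))"
    using assms unfolding poly_fun_def by auto
  show ?thesis
    unfolding poly_fun_def c
    by (rule exI[of _ "\<lambda>e. a * c e"]) (simp add: sum_distrib_left mult.assoc)
qed

lemma poly_fun_0: "poly_fun k (\<lambda>x. 0)"
  unfolding poly_fun_def by (rule exI[of _ "\<lambda>_. 0"]) simp

text \<open>On the line from an interior point \<open>x0\<close> of \<open>T\<close> towards
  \<open>y\<close> the difference has infinitely many roots near \<open>t = 0\<close>, hence is 0;
  the value \<open>t = 1\<close> is the point \<open>y\<close>. This uniqueness determines the
  choice made in \<open>poly_piece\<close>.\<close>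

lemma poly_fun_eqI:
  fixes p r :: "'a::euclidean_space \<Rightarrow> real"
  assumes "poly_fun k p" "poly_fun k r" "interior T \<noteq> {}" "\<And>x. x \<in> T \<Longrightarrow> p x = r x"
  shows "p = r"
proof
  fix y
  obtain x0 e where e: "e > 0" "ball x0 e \<subseteq> T"
    using assms(3) by (metis ex_in_conv mem_interior)
  define n where "n = y - x0"
  have pr: "poly_fun k (\<lambda>x. p x + (-1) * r x)"
    using assms by (intro poly_fun_add poly_fun_scale)
  obtain q where q: "\<And>x t. p (x + t *\<^sub>R n) + (-1) * r (x + t *\<^sub>R n) = poly (q x) t"
    using poly_fun_on_lineE[OF pr, of n] by metis
  \<comment> \<open>The added 1 covers the case \<open>n = 0\<close>.\<close>
  let ?d = "e / (norm n + 1)"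
  have d: "?d > 0" using e(1) by (simp add: add_nonneg_pos)
  have "{0<..<?d} \<subseteq> {t. poly (q x0) t = 0}"
  proof
    fix t assume t: "t \<in> {0<..<?d}"
    have "t * norm n \<le> t * (norm n + 1)" using t by (simp add: algebra_simps)
    also have "\<dots> < e" using t by (simp add: pos_less_divide_eq add_nonneg_pos)
    finally have "x0 + t *\<^sub>R n \<in> ball x0 e" using t by (simp add: dist_norm)
    then have "p (x0 + t *\<^sub>R n) = r (x0 + t *\<^sub>R n)" using assms(4) e(2) by auto
    then show "t \<in> {t. poly (q x0) t = 0}" using q[of x0 t] by simp
  qed
  then have "infinite {t. poly (q x0) t = 0}"
    using d infinite_Ioo finite_subset by blast
  then have "q x0 = 0" using poly_roots_finite by blast
  then show "p y = r y" using q[of x0 1] by (simp add: n_def)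
qed

lemma differentiable_poly_fun:
  assumes "poly_fun k p"
  shows "p differentiable at x"
proof -
  obtain c where c: "p = (\<lambda>x. \<Sum>e\<in>{e \<in> Basis \<rightarrow>\<^sub>E {..k}. sum e Basis \<le> k}. c e * (\<Prod>b\<in>Basis. (x \<bullet> b) ^ e b))"
    using assms unfolding poly_fun_def by auto
  have "(\<lambda>x::'a. \<Prod>b\<in>B. (x \<bullet> b) ^ e b) differentiable at x" for e :: "'a \<Rightarrow> nat" and B
  proof (induction B rule: infinite_finite_induct)
    case (insert b B)
    have "(\<lambda>x::'a. (x \<bullet> b) ^ e b) differentiable at x"
      by (intro differentiable_power differentiable_inner differentiable_ident differentiable_const)
    then show ?case using insert by (simp add: differentiable_mult)
  qed simp_all
  moreover have "finite {e \<in> (Basis :: 'a set) \<rightarrow>\<^sub>E {..k}. sum e Basis \<le> k}"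
    by (rule finite_subset[of _ "Basis \<rightarrow>\<^sub>E {..k}"]) (auto intro!: finite_PiE)
  ultimately show ?thesis
    unfolding c by (intro differentiable_sum ballI differentiable_mult differentiable_const)
qed

text \<open>Transfers the continuity of directional derivatives, known from the coefficients, to
  gradients of polynomials.\<close>

lemma frechet_derivative_poly_fun:
  assumes "poly_fun k p"
  shows "frechet_derivative p (at x) b = dir_deriv 1 b p x"
proof -
  let ?D = "frechet_derivative p (at x)"
  have D: "(p has_derivative ?D) (at x)"
    using differentiable_poly_fun[OF assms] frechet_derivative_works by blast
  have "((\<lambda>t::real. x + t *\<^sub>R b) has_derivative (\<lambda>t. t *\<^sub>R b)) (at 0)"
    by (auto intro!: derivative_eq_intros)
  moreover have "(p has_derivative ?D) (at (x + 0 *\<^sub>R b))"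
    using D by simp
  ultimately have "(p \<circ> (\<lambda>t. x + t *\<^sub>R b) has_derivative ?D \<circ> (\<lambda>t. t *\<^sub>R b)) (at 0)"
    by (rule diff_chain_at)
  moreover have "?D \<circ> (\<lambda>t. t *\<^sub>R b) = (*) (?D b)"
    using linear_scale[OF has_derivative_linear[OF D]] by (simp add: fun_eq_iff)
  ultimately have "((\<lambda>t::real. p (x + t *\<^sub>R b)) has_field_derivative ?D b) (at 0)"
    by (simp add: has_field_derivative_def comp_def)
  then show ?thesis by (simp add: dir_deriv_def DERIV_imp_deriv)
qed

lemma continuous_on_grad_poly_fun:
  assumes "poly_fun k p"
  shows "continuous_on UNIV (grad_on UNIV p)"
  unfolding grad_on_def frechet_derivative_poly_fun[OF assms]
  using continuous_on_dir_deriv[OF assms] by (intro continuous_intros) auto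

section \<open>Surface measure of bounded subsets of hyperplanes\<close>

text \<open>
  The set is covered by the cells of an orthonormal grid of width \<open>R / K\<close> in the affine subspace. There
  are at most \<open>(3 K)\<^sup>m\<close> of them, of diameter at most \<open>m R / K\<close>, so the bound is independent of \<open>K\<close>.
\<close>

lemma hausdorff_pre_affine_bounded:
  fixes S :: "'a::euclidean_space set"
  assumes V: "subspace V" "dim V = m" "m \<ge> 1"
    and S: "bounded S" "\<And>x. x \<in> S \<Longrightarrow> x - x0 \<in> V"
  obtains C where "\<And>\<delta>. \<delta> > 0 \<Longrightarrow> hausdorff_pre m \<delta> S \<le> ennreal C"
proof -
  obtain B where B: "pairwise orthogonal B" "\<And>x. x \<in> B \<Longrightarrow> norm x = 1"
      "independent B" "card B = m" "span B = V"
    using orthonormal_basis_subspace[OF V(1)] V(2) by metis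
  have finB: "finite B" using B(3) by (rule independent_imp_finite)
  have "bounded ((\<lambda>x. x - x0) ` S)" using S(1) by (rule bounded_translation_minus)
  then obtain R where R: "R > 0" "\<And>x. x \<in> S \<Longrightarrow> norm (x - x0) \<le> R"
    by (auto simp: bounded_pos)
  have vol: "unit_ball_vol (real m) \<ge> 0" by simp
  define C where "C = unit_ball_vol (real m) * (3 * real m * R / 2) ^ m"
  have "hausdorff_pre m \<delta> S \<le> ennreal C" if \<delta>: "\<delta> > 0" for \<delta>
  proof -
    obtain K0 :: nat where K0: "real m * R / \<delta> < real K0" using reals_Archimedean2 by blast
    define K where "K = Suc K0"
    have K: "K \<ge> 1" "real m * R / \<delta> \<le> real K" using K0 by (auto simp: K_def)
    define \<rho> where "\<rho> = R / real K"
    have \<rho>: "\<rho> > 0" using R(1) K(1) by (simp add: \<rho>_def)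
    have m\<rho>: "real m * \<rho> \<le> \<delta>"
      using K \<delta> by (simp add: \<rho>_def field_simps)
    define E where "E = B \<rightarrow>\<^sub>E {- int K..int K}"
    have finE: "finite E" unfolding E_def using finB by (intro finite_PiE) auto
    have "card E = (2 * K + 1) ^ m"
      unfolding E_def using finB B(4) by (simp add: card_PiE nat_add_distrib nat_mult_distrib)
    also have "\<dots> \<le> (3 * K) ^ m" using K(1) by (intro power_mono) auto
    finally have cardE: "card E \<le> (3 * K) ^ m" .
    define cell where "cell e = {x \<in> S. \<forall>b\<in>B. \<lfloor>((x - x0) \<bullet> b) / \<rho>\<rfloor> = e b}" for e :: "'a \<Rightarrow> int"
    have cover: "\<exists>e\<in>E. x \<in> cell e" if x: "x \<in> S" for x
    proof (intro bexI)
      let ?e = "\<lambda>b\<in>B. \<lfloor>((x - x0) \<bullet> b) / \<rho>\<rfloor>"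
      show "x \<in> cell ?e" using x by (simp add: cell_def)
      have "\<lfloor>((x - x0) \<bullet> b) / \<rho>\<rfloor> \<in> {- int K..int K}" if b: "b \<in> B" for b
      proof -
        have "\<bar>(x - x0) \<bullet> b\<bar> \<le> norm (x - x0) * norm b" by (rule Cauchy_Schwarz_ineq2)
        also have "\<dots> \<le> R" using R(2)[OF x] B(2)[OF b] by simp
        finally have "\<bar>(x - x0) \<bullet> b\<bar> \<le> R" .
        then have "\<bar>(x - x0) \<bullet> b / \<rho>\<bar> \<le> real K"
          using \<rho> K(1) R(1) by (simp add: \<rho>_def field_simps abs_mult)
        then have "- real K \<le> (x - x0) \<bullet> b / \<rho>" "(x - x0) \<bullet> b / \<rho> \<le> real K"
          by linarith+
        then show ?thesis
          by (auto simp: le_floor_iff intro: order_trans[OF of_int_floor_le])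
             (metis floor_mono floor_of_nat)
      qed
      then show "?e \<in> E" by (simp add: E_def)
    qed
    have diam: "diameter (cell e) \<le> real m * \<rho>" for e
    proof (rule diameter_le)
      show "cell e \<noteq> {} \<or> 0 \<le> real m * \<rho>" using \<rho> by simp
      fix x y assume xy: "x \<in> cell e" "y \<in> cell e"
      have "(x - x0) - (y - x0) \<in> V"
        using xy by (intro subspace_diff[OF V(1)] S(2)) (simp_all add: cell_def)
      then have "x - y \<in> span B" using B(5) by simp
      then have "x - y = (\<Sum>b\<in>B. ((x - y) \<bullet> b) *\<^sub>R b)"
        using orthonormal_basis_expand[OF B(1) B(2) _ finB] by simp
      also have "norm \<dots> \<le> (\<Sum>b\<in>B. norm (((x - y) \<bullet> b) *\<^sub>R b))" by (rule norm_sum)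
      also have "\<dots> \<le> (\<Sum>b\<in>B. \<rho>)"
      proof (rule sum_mono)
        fix b assume b: "b \<in> B"
        have "\<lfloor>((x - x0) \<bullet> b) / \<rho>\<rfloor> = \<lfloor>((y - x0) \<bullet> b) / \<rho>\<rfloor>"
          using xy b by (simp add: cell_def)
        then have "\<bar>((x - x0) \<bullet> b) / \<rho> - ((y - x0) \<bullet> b) / \<rho>\<bar> \<le> 1" by linarith
        then have "\<bar>((x - y) \<bullet> b) / \<rho>\<bar> \<le> 1"
          by (simp add: diff_divide_distrib[symmetric] inner_diff_left)
        then show "norm (((x - y) \<bullet> b) *\<^sub>R b) \<le> \<rho>"
          using \<rho> B(2)[OF b] by (simp add: abs_div_pos[symmetric] pos_divide_le_eq)
      qed
      finally show "norm (x - y) \<le> real m * \<rho>" using B(4) by simp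
    qed
    have bcell: "bounded (cell e)" for e
      by (rule bounded_subset[OF S(1)]) (auto simp: cell_def)
    obtain f where f: "bij_betw f {0..<card E} E" using ex_bij_betw_nat_finite[OF finE] by blast
    define c where "c n = (if n < card E then cell (f n) else {})" for n
    let ?w = "\<lambda>n. ennreal (unit_ball_vol (real m) * (diameter (c n) / 2) ^ m)"
    have "S \<subseteq> (\<Union>n. c n)"
    proof
      fix x assume "x \<in> S"
      then obtain e where e: "e \<in> E" "x \<in> cell e" using cover by blast
      then have "e \<in> f ` {0..<card E}" using f by (simp add: bij_betw_def)
      then obtain n where "n < card E" "e = f n" by auto
      then show "x \<in> (\<Union>n. c n)" using e(2) by (auto simp: c_def)
    qed
    moreover have "bounded (c n) \<and> diameter (c n) \<le> \<delta>" for n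
      using bcell diam[of "f n"] m\<rho> \<delta> by (auto simp: c_def)
    ultimately have "hausdorff_pre m \<delta> S \<le> (\<Sum>n. ?w n)"
      unfolding hausdorff_pre_def by (intro INF_lower) auto
    \<comment> \<open>The sequence is padded with empty sets of diameter 0; their terms vanish since
      \<open>0 ^ m = 0\<close> for \<open>m \<ge> 1\<close>.\<close>
    also have "\<dots> = (\<Sum>n\<in>{..<card E}. ?w n)"
      using V(3) by (intro suminf_finite) (auto simp: c_def power_0_left)
    also have "\<dots> \<le> (\<Sum>n\<in>{..<card E}. ennreal (unit_ball_vol (real m) * (real m * \<rho> / 2) ^ m))"
    proof (intro sum_mono ennreal_leI mult_left_mono power_mono)
      fix n
      show "diameter (c n) / 2 \<le> real m * \<rho> / 2" using diam[of "f n"] \<rho> by (auto simp: c_def)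
      show "0 \<le> diameter (c n) / 2" using diameter_ge_0[OF bcell] by (auto simp: c_def)
    qed (rule vol)
    also have "\<dots> = ennreal (real (card E) * (unit_ball_vol (real m) * (real m * \<rho> / 2) ^ m))"
      using \<rho> vol by (simp add: ennreal_mult ennreal_of_nat_eq_real_of_nat)
    also have "\<dots> \<le> ennreal (real ((3 * K) ^ m) * (unit_ball_vol (real m) * (real m * \<rho> / 2) ^ m))"
      using cardE \<rho> vol by (intro ennreal_leI mult_right_mono of_nat_mono) auto
    also have "real ((3 * K) ^ m) * (unit_ball_vol (real m) * (real m * \<rho> / 2) ^ m) =
        unit_ball_vol (real m) * (3 * real K * (real m * \<rho> / 2)) ^ m"
      by (simp only: power_mult_distrib of_nat_power of_nat_mult of_nat_numeral mult_ac)
    also have "3 * real K * (real m * \<rho> / 2) = 3 * real m * R / 2"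
      using K(1) by (simp add: \<rho>_def)
    finally show ?thesis by (simp add: C_def)
  qed
  then show ?thesis by (rule that)
qed

lemma sets_surface_measure: "sets surface_measure = sets borel"
  by (simp add: surface_measure_def sigma_algebra.sigma_sets_eq[OF sets.sigma_algebra_axioms, of borel, simplified])

text \<open>Seen from a point of \<open>S\<close> the hyperplane is a subspace of dimension
  \<open>DIM('a) - 1\<close>, which is at least 1. The grid bound is the same for every \<delta>, so
  it survives the supremum.\<close>

lemma emeasure_surface_hyperplane_finite:
  fixes S :: "'a::euclidean_space set"
  assumes "DIM('a) \<ge> 2" "a \<noteq> 0" "S \<subseteq> {x. a \<bullet> x = b}" "bounded S"
  shows "emeasure surface_measure S < \<infinity>"
proof (cases "S = {}")
  case False
  then obtain x0 where x0: "x0 \<in> S" by blast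
  let ?V = "{x. a \<bullet> x = 0}"
  obtain C where C: "\<And>\<delta>. \<delta> > 0 \<Longrightarrow> hausdorff_pre (DIM('a) - 1) \<delta> S \<le> ennreal C"
  proof (rule hausdorff_pre_affine_bounded[of ?V "DIM('a) - 1" S x0])
    show "subspace ?V" by (rule subspace_hyperplane)
    show "dim ?V = DIM('a) - 1" using assms(2) by (rule dim_hyperplane)
    show "x - x0 \<in> ?V" if "x \<in> S" for x
      using that x0 assms(3) by (auto simp: inner_diff_right)
  qed (use assms in auto)
  \<comment> \<open>Countable additivity is not needed: where it fails, \<open>measure_of\<close> yields the null measure.\<close>
  have "emeasure surface_measure S \<le> (SUP \<delta>\<in>{0<..}. hausdorff_pre (DIM('a) - 1) \<delta> S)"
    unfolding surface_measure_def by (simp add: emeasure_measure_of_conv)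
  also have "\<dots> \<le> ennreal C" using C by (intro SUP_least) auto
  finally show ?thesis by (simp add: order_le_less_trans)
qed simp

lemma set_integrable_surface_hyperplane:
  fixes f :: "'a::euclidean_space \<Rightarrow> real"
  assumes "DIM('a) \<ge> 2" "a \<noteq> 0" "S \<subseteq> {x. a \<bullet> x = b}" "compact S" "continuous_on UNIV f"
  shows "set_integrable surface_measure S f"
proof -
  have "bounded (f ` S)"
    using assms by (intro compact_imp_bounded compact_continuous_image) (auto intro: continuous_on_subset)
  then obtain R where R: "\<And>x. x \<in> S \<Longrightarrow> norm (f x) \<le> R" by (auto simp: bounded_iff)
  show ?thesis
    unfolding set_integrable_def
  proof (rule integrableI_bounded_set_indicator[where B = R])
    show "S \<in> sets surface_measure"
      using assms(4) by (simp add: sets_surface_measure compact_imp_closed)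
    show "f \<in> borel_measurable surface_measure"
      using borel_measurable_continuous_onI[OF assms(5)]
      by (simp cong: measurable_cong_sets add: sets_surface_measure)
    show "emeasure surface_measure S < \<infinity>"
      using assms by (intro emeasure_surface_hyperplane_finite compact_imp_bounded)
  qed (use R in auto)
qed

section \<open>Facets of a triangulation\<close>

text \<open>A small step from \<open>x\<close> towards \<open>w1\<close> ends in the interior of
  \<open>T1\<close>. With \<open>w1 - x = s *\<^sub>R (w2 - x) + h\<close> and \<open>h\<close>
  parallel to the hyperplane, the same point is a convex combination of \<open>w2\<close> and
  \<open>x + \<eta> *\<^sub>R h\<close>, and the latter lies in \<open>F\<close> for a small step
  because \<open>x\<close> is a relative interior point. Hence it also lies in
  \<open>T2\<close>.\<close>

lemma same_side_interior_meets:
  fixes T1 T2 :: "'a::euclidean_space set"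
  assumes "convex T1" "convex T2" "F \<subseteq> T1" "F \<subseteq> T2" "x \<in> rel_interior F"
    and aff: "affine hull F = {y. a \<bullet> y = b}"
    and w: "w1 \<in> interior T1" "w2 \<in> T2" "(a \<bullet> w1 - b) * (a \<bullet> w2 - b) > 0"
  shows "interior T1 \<inter> T2 \<noteq> {}"
proof -
  \<comment> \<open>Ratio of the heights of \<open>w1\<close> and \<open>w2\<close> over the
    hyperplane, positive because they are on the same side; it makes \<open>h\<close> parallel to
    the hyperplane.\<close>
  define s where "s = (a \<bullet> w1 - b) / (a \<bullet> w2 - b)"
  have w2: "a \<bullet> w2 - b \<noteq> 0" using w(3) by auto
  have s: "s > 0" using w(3) by (auto simp: s_def zero_less_mult_iff zero_less_divide_iff)
  have xF: "x \<in> F" using assms(5) rel_interior_subset by blast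
  have ax: "a \<bullet> x = b" using xF aff hull_inc[of x F] by auto
  define h where "h = w1 - x - s *\<^sub>R (w2 - x)"
  have ah: "a \<bullet> h = 0"
    using w2 by (simp add: h_def inner_diff_right ax s_def)
  obtain e where e: "e > 0" "ball x e \<inter> affine hull F \<subseteq> F"
    using assms(5) by (auto simp: mem_rel_interior_ball)
  \<comment> \<open>The bound 1 keeps the step within the segment to \<open>w1\<close>;
    \<open>1 / (2 * s)\<close> gives \<open>1 - \<epsilon> * s \<ge> 1 / 2\<close>, hence
    \<open>\<eta> \<le> 2 * \<epsilon>\<close>; the last bound then keeps
    \<open>\<eta> * norm h\<close> below the radius \<open>e\<close>.\<close>
  define \<epsilon> where "\<epsilon> = min 1 (min (1 / (2 * s)) (e / (4 * (norm h + 1))))"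
  have h1: "norm h + 1 > 0" by (simp add: add_nonneg_pos)
  have \<epsilon>: "\<epsilon> > 0" "\<epsilon> \<le> 1" "\<epsilon> \<le> 1 / (2 * s)" "\<epsilon> \<le> e / (4 * (norm h + 1))"
    using s e h1 by (auto simp: \<epsilon>_def)
  have \<epsilon>s: "\<epsilon> * s \<le> 1 / 2" using \<epsilon>(3) s by (simp add: field_simps)
  have \<epsilon>h: "2 * \<epsilon> * norm h < e"
  proof -
    have "2 * \<epsilon> * norm h \<le> 2 * \<epsilon> * (norm h + 1)" using \<epsilon>(1) by simp
    also have "\<dots> \<le> e / 2" using \<epsilon>(4) h1 by (simp add: field_simps)
    also have "\<dots> < e" using e by simp
    finally show ?thesis .
  qed
  define \<eta> where "\<eta> = \<epsilon> / (1 - \<epsilon> * s)"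
  have "\<eta> \<le> 2 * \<epsilon>"
    using \<epsilon>(1) \<epsilon>s mult_left_mono[of "1 / 2" "1 - \<epsilon> * s" "2 * \<epsilon>"]
    by (simp add: \<eta>_def pos_divide_le_eq)
  then have "\<eta> * norm h \<le> 2 * \<epsilon> * norm h" by (rule mult_right_mono) simp
  moreover have \<eta>0: "\<eta> \<ge> 0" using \<epsilon> \<epsilon>s by (simp add: \<eta>_def)
  ultimately have "x + \<eta> *\<^sub>R h \<in> ball x e" using \<epsilon>h by (simp add: dist_norm)
  moreover have "x + \<eta> *\<^sub>R h \<in> affine hull F" by (simp add: aff inner_add_right ax ah)
  ultimately have "x + \<eta> *\<^sub>R h \<in> T2" using e(2) assms(4) by blast
  then have "(1 - \<epsilon> * s) *\<^sub>R (x + \<eta> *\<^sub>R h) + (\<epsilon> * s) *\<^sub>R w2 \<in> T2"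
    using assms(2) w(2) \<epsilon>s \<epsilon>(1) s by (intro convexD) auto
  moreover have "(1 - \<epsilon> * s) *\<^sub>R (\<eta> *\<^sub>R h) = \<epsilon> *\<^sub>R h"
    using \<epsilon>s by (simp add: \<eta>_def)
  then have "(1 - \<epsilon> * s) *\<^sub>R (x + \<eta> *\<^sub>R h) + (\<epsilon> * s) *\<^sub>R w2 = x - \<epsilon> *\<^sub>R (x - w1)"
    unfolding scaleR_add_right[of _ x] by (simp add: h_def algebra_simps)
  moreover have "x - \<epsilon> *\<^sub>R (x - w1) \<in> interior T1"
    using assms(1,3) w(1) xF \<epsilon> by (intro mem_interior_convex_shrink) auto
  ultimately show ?thesis by auto
qed

text \<open>A proper face misses the interior, so the common face is all of \<open>T1\<close> and
  all of \<open>T2\<close>.\<close>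

lemma triangulation_eqI:
  assumes "triangulation \<T>" "T1 \<in> \<T>" "T2 \<in> \<T>"
    and "interior T1 \<inter> T2 \<noteq> {}" "interior T2 \<inter> T1 \<noteq> {}"
  shows "T1 = T2"
proof -
  have "T1 \<inter> T2 face_of T1" "T2 \<inter> T1 face_of T2"
    using assms(1-3) by (auto simp: triangulation_def)
  then have "T1 \<inter> T2 = T1" "T2 \<inter> T1 = T2"
    using face_of_disjoint_interior assms(4,5) interior_subset by blast+
  then show ?thesis by blast
qed

lemma facet_affine_hull:
  fixes T :: "'a::euclidean_space set"
  assumes "F facet_of T" "interior T \<noteq> {}"
  obtains a b where "a \<noteq> 0" "affine hull F = {x. a \<bullet> x = b}"
proof -
  have "aff_dim F = DIM('a) - 1"
    using assms by (simp add: facet_of_def aff_dim_nonempty_interior)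
  then show ?thesis using that unfolding aff_dim_eq_hyperplane by blast
qed

text \<open>A face of a convex set is cut out by its affine hull. Thus interior points of
  \<open>T\<close> have nonzero height over the hyperplane of \<open>F\<close>, and its sign tells
  the two sides apart.\<close>

lemma facet_disjoint_interior:
  fixes T :: "'a::euclidean_space set"
  assumes "F facet_of T" "convex T"
  shows "affine hull F \<inter> interior T = {}"
proof -
  have F: "F face_of T" "F \<noteq> T" using assms(1) by (auto simp: facet_of_def)
  have "affine hull F \<inter> T = F"
    using F(1) assms(2) by (metis face_of_imp_eq_affine_Int Int_commute)
  then show ?thesis
    using face_of_disjoint_interior[OF F] interior_subset by blast
qed

text \<open>Among three simplices sharing a facet, two lie on the same side of its hyperplane, and these
  overlap near a relative interior point of the facet.\<close>

lemma facet_shared_by_two: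
  fixes T1 T2 T3 :: "'a::euclidean_space set"
  assumes tri: "triangulation \<T>"
    and T: "T1 \<in> \<T>" "T2 \<in> \<T>" "T3 \<in> \<T>"
    and int: "interior T1 \<noteq> {}" "interior T2 \<noteq> {}" "interior T3 \<noteq> {}"
    and F: "F facet_of T1" "F facet_of T2" "F facet_of T3"
  shows "T1 = T2 \<or> T1 = T3 \<or> T2 = T3"
proof -
  have conv: "convex T" if "T \<in> \<T>" for T
    using tri that by (auto simp: triangulation_def intro: convex_simplex)
  obtain a b where ab: "affine hull F = {x. a \<bullet> x = b}"
    using facet_affine_hull[OF F(1) int(1)] by metis
  have "convex F" "F \<noteq> {}" using F(1) by (auto simp: facet_of_def face_of_imp_convex)
  then obtain x where x: "x \<in> rel_interior F" using rel_interior_eq_empty by blast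
  have ne: "a \<bullet> w - b \<noteq> 0" if "w \<in> interior T" "F facet_of T" "T \<in> \<T>" for w T
    using facet_disjoint_interior[OF that(2) conv[OF that(3)]] that(1) ab by auto
  have eq: "T = T'" if "w \<in> interior T" "w' \<in> interior T'" "(a \<bullet> w - b) * (a \<bullet> w' - b) > 0"
      "T \<in> \<T>" "T' \<in> \<T>" "F facet_of T" "F facet_of T'" for w w' T T'
  proof (rule triangulation_eqI[OF tri that(4,5)])
    have sub: "F \<subseteq> T" "F \<subseteq> T'" using that by (auto simp: facet_of_def dest: face_of_imp_subset)
    have "w \<in> T" "w' \<in> T'" using that interior_subset by auto
    then show "interior T \<inter> T' \<noteq> {}" "interior T' \<inter> T \<noteq> {}"
      using same_side_interior_meets[OF conv conv sub x ab that(1) _ that(3)]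
        same_side_interior_meets[OF conv conv sub(2,1) x ab that(2), of w] that
      by (auto simp: mult.commute)
  qed
  obtain w1 w2 w3 where w: "w1 \<in> interior T1" "w2 \<in> interior T2" "w3 \<in> interior T3"
    using int by blast
  have "(a \<bullet> w1 - b) * (a \<bullet> w2 - b) > 0 \<or> (a \<bullet> w1 - b) * (a \<bullet> w3 - b) > 0 \<or>
      (a \<bullet> w2 - b) * (a \<bullet> w3 - b) > 0"
    using ne[OF w(1) F(1) T(1)] ne[OF w(2) F(2) T(2)] ne[OF w(3) F(3) T(3)]
    by (auto simp: zero_less_mult_iff)
  then show ?thesis using eq w T F by blast
qed

section \<open>Finite element functions on a cut mesh\<close>

text \<open>The derivative relative to \<open>S\<close> is a choice and determined only where limits
  are; as \<open>x\<close> is interior to \<open>S\<close>, \<open>at x within S\<close> is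
  \<open>at x\<close>, and local agreement with \<open>p\<close> fixes the value.\<close>

lemma grad_on_locally_eq:
  fixes f p :: "'a::euclidean_space \<Rightarrow> real"
  assumes "open W" "x \<in> W" "W \<subseteq> S" "\<And>y. y \<in> W \<Longrightarrow> f y = p y" "p differentiable at x"
  shows "grad_on S f x = grad_on UNIV p x" "f differentiable at x"
proof -
  have "(p has_derivative frechet_derivative p (at x)) (at x)"
    using assms(5) frechet_derivative_works by blast
  then have f: "(f has_derivative frechet_derivative p (at x)) (at x)"
    by (rule has_derivative_transform_within_open[OF _ assms(1,2)]) (simp add: assms(4))
  then show "f differentiable at x" by (auto simp: differentiable_def)
  have "x \<in> interior S" using assms(1-3) by (meson interiorI)
  then have "at x within S = at x" by (rule at_within_interior)
  then show "grad_on S f x = grad_on UNIV p x"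
    using frechet_derivative_at[OF f] by (simp add: grad_on_def)
qed

lemma grad_on_add:
  assumes "f differentiable at x" "g differentiable at x"
  shows "grad_on UNIV (\<lambda>y. f y + g y) x = grad_on UNIV f x + grad_on UNIV g x"
proof -
  have "((\<lambda>y. f y + g y) has_derivative
      (\<lambda>h. frechet_derivative f (at x) h + frechet_derivative g (at x) h)) (at x)"
    using assms frechet_derivative_works by (intro has_derivative_add) blast+
  from frechet_derivative_at[OF this, symmetric] show ?thesis
    by (simp add: grad_on_def scaleR_add_left sum.distrib)
qed

lemma grad_on_scale:
  assumes "f differentiable at x"
  shows "grad_on UNIV (\<lambda>y. c * f y) x = c *\<^sub>R grad_on UNIV f x"
proof -
  have "((\<lambda>y. c * f y) has_derivative (\<lambda>h. c * frechet_derivative f (at x) h)) (at x)"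
    using assms frechet_derivative_works by (intro has_derivative_mult_right) blast
  from frechet_derivative_at[OF this, symmetric] show ?thesis
    by (simp add: grad_on_def scaleR_sum_right)
qed

lemma set_integrable_lebesgue_continuous:
  fixes f :: "'a::euclidean_space \<Rightarrow> real"
  assumes "continuous_on UNIV f" "bounded S" "S \<in> sets lebesgue"
  shows "set_integrable lebesgue S f"
proof -
  obtain a where a: "S \<subseteq> cbox (- a) a" using bounded_subset_cbox_symmetric[OF assms(2)] by blast
  have "set_integrable lebesgue (cbox (- a) a) f"
    using assms(1) by (intro absolutely_integrable_continuous) (auto intro: continuous_on_subset)
  then show ?thesis using assms(3) a by (rule set_integrable_subset)
qed

lemma finite_extreme_points_simplex: "n simplex T \<Longrightarrow> finite {v. v extreme_point_of T}"
  by (intro finite_polyhedron_extreme_points simplex_imp_polyhedron)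

text \<open>The weights are functions on the whole type, of which there may be infinitely many, but
  a node depends only on their values at the vertices, which are at most \<open>k\<close>.\<close>

lemma finite_lagrange_nodes:
  assumes "n simplex T"
  shows "finite (lagrange_nodes k T)"
proof -
  let ?C = "{v. v extreme_point_of T}"
  let ?g = "\<lambda>a::'a \<Rightarrow> nat. \<Sum>v\<in>?C. (real (a v) / real k) *\<^sub>R v"
  have fin: "finite ?C" using assms by (rule finite_extreme_points_simplex)
  have "lagrange_nodes k T \<subseteq> ?g ` (?C \<rightarrow>\<^sub>E {..k})"
  proof
    fix y assume "y \<in> lagrange_nodes k T"
    then obtain a where a: "y = ?g a" "sum a ?C = k" by (auto simp: lagrange_nodes_def Let_def)
    have "a v \<le> k" if "v \<in> ?C" for v
      using member_le_sum[of v ?C a] that fin a(2) by simp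
    then have r: "restrict a ?C \<in> ?C \<rightarrow>\<^sub>E {..k}" by auto
    have "y = ?g (restrict a ?C)" unfolding a(1) by (rule sum.cong) auto
    then show "y \<in> ?g ` (?C \<rightarrow>\<^sub>E {..k})" by (rule image_eqI[OF _ r])
  qed
  then show ?thesis by (rule finite_subset) (use fin in \<open>simp add: finite_PiE\<close>)
qed

text \<open>A single configuration; the uniform statement interprets it for each member of the
  family. \<open>regular_open\<close> is the contribution of the polygonal domain: it excludes
  slits, so that interiors of simplices tiling the closure lie in \<Omega>.\<close>

locale cut_mesh =
  fixes k :: nat and \<Omega> :: "'a::euclidean_space set" and M :: "('a, 'm) cut_config_scheme"
  assumes dim_ge_2: "DIM('a) \<ge> 2"
    and regular_open: "interior (closure \<Omega>) = \<Omega>"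
    and partition: "partition_of \<Omega> M"
    and mesh: "mesh_of \<Omega> (mesh M)"
    and basis: "nodal_basis k \<Omega> M"
    and ghost: "ghost_faces M"
begin

section \<open>Geometry of the mesh, its skeleton and the extended regions\<close>

lemma finite_mesh: "finite (mesh M)"
  using mesh by (simp add: mesh_of_def triangulation_def)

lemma mesh_simplex: "T \<in> mesh M \<Longrightarrow> int DIM('a) simplex T"
  using mesh by (simp add: mesh_of_def)

lemma mesh_convex: "T \<in> mesh M \<Longrightarrow> convex T"
  by (rule convex_simplex[OF mesh_simplex])

lemma mesh_compact: "T \<in> mesh M \<Longrightarrow> compact T"
  by (rule compact_simplex[OF mesh_simplex])

lemma mesh_interior: assumes "T \<in> mesh M" shows "interior T \<noteq> {}"
proof -
  have "aff_dim T = int DIM('a)" using aff_dim_simplex[OF mesh_simplex[OF assms]] .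
  then have "affine hull T = UNIV" by (simp add: aff_dim_eq_full)
  then have "rel_interior T = interior T" by (rule rel_interior_interior)
  moreover have "T \<noteq> {}" using \<open>aff_dim T = int DIM('a)\<close> by auto
  ultimately show ?thesis using rel_interior_eq_empty[OF mesh_convex[OF assms]] by simp
qed

lemma Union_mesh: "\<Union>(mesh M) = closure \<Omega>"
  using mesh by (simp add: mesh_of_def)

text \<open>The complement of the mesh skeleton; finite element functions are differentiable here.\<close>

definition core :: "'a set" where "core = (\<Union>T\<in>mesh M. interior T)"

lemma open_core: "open core"
  by (auto simp: core_def)

lemma core_subset: "core \<subseteq> \<Omega>"
proof -
  have "core \<subseteq> interior (closure \<Omega>)"
    using interior_subset Union_mesh by (intro interior_maximal open_core) (auto simp: core_def)
  then show ?thesis by (simp add: regular_open)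
qed

text \<open>A point of the closure lies in some simplex; if it is interior to none, it is on the
  frontier of that simplex. Frontiers of convex sets are null, and there are finitely many.\<close>

lemma negligible_off_core: "negligible (closure \<Omega> - core)"
proof (rule negligible_subset)
  show "negligible (\<Union>T\<in>mesh M. frontier T)"
    using finite_mesh mesh_convex by (intro negligible_Union) (auto intro: negligible_convex_frontier)
  show "closure \<Omega> - core \<subseteq> (\<Union>T\<in>mesh M. frontier T)"
    unfolding Union_mesh[symmetric] core_def frontier_def using closure_subset by fastforce
qed

lemma closed_ext_region: "closed (ext_region M i)"
  using finite_mesh mesh_compact unfolding ext_region_def
  by (intro closed_Union) (auto intro: compact_imp_closed)

lemma ext_region_subset: "ext_region M i \<subseteq> closure \<Omega>"
  unfolding Union_mesh[symmetric] ext_region_def by blast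

lemma mesh_subset_ext_region:
  "T \<in> mesh M \<Longrightarrow> T \<inter> subdom M i \<noteq> {} \<Longrightarrow> T \<subseteq> ext_region M i"
  by (auto simp: ext_region_def)

text \<open>If \<open>x\<close> is interior to \<open>T'\<close> and lies in \<open>T\<close>, the
  face \<open>T' \<inter> T\<close> of \<open>T'\<close> meets the interior of \<open>T'\<close> and
  so equals \<open>T'\<close>. The region thus contains a whole neighbourhood: its boundary lies on
  the skeleton.\<close>

lemma ext_region_core: "ext_region M i \<inter> core \<subseteq> interior (ext_region M i)"
proof
  fix x assume x: "x \<in> ext_region M i \<inter> core"
  then obtain T where T: "T \<in> mesh M" "T \<inter> subdom M i \<noteq> {}" "x \<in> T" by (auto simp: ext_region_def)
  obtain T' where T': "T' \<in> mesh M" "x \<in> interior T'" using x by (auto simp: core_def)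
  have "T' \<inter> T face_of T'"
    using mesh T(1) T'(1) by (auto simp: mesh_of_def triangulation_def)
  moreover have "x \<in> (T' \<inter> T) \<inter> interior T'" using T(3) T'(2) interior_subset by auto
  ultimately have "T' \<inter> T = T'" using face_of_disjoint_interior by blast
  then have "T' \<subseteq> ext_region M i" using T by (auto simp: ext_region_def)
  then show "x \<in> interior (ext_region M i)" using T'(2) interior_mono by blast
qed

lemma subdom_subset: assumes "i \<in> {1, 2}" shows "subdom M i \<subseteq> \<Omega>"
proof -
  have "\<Omega> = subdom M 1 \<union> subdom M 2 \<union> (interface M \<inter> \<Omega>)"
    using partition by (simp add: partition_of_def)
  then show ?thesis using assms by blast
qed

text \<open>The extended region is closed, so it absorbs limit points. In particular both regions
  contain the interface, and the two truncations of \<open>u\<close> agree there.\<close>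

lemma closure_subdom_subset: assumes "i \<in> {1, 2}" shows "closure (subdom M i) \<subseteq> ext_region M i"
proof (rule closure_minimal[OF _ closed_ext_region])
  show "subdom M i \<subseteq> ext_region M i"
  proof
    fix x assume x: "x \<in> subdom M i"
    then have "x \<in> \<Union>(mesh M)" using subdom_subset[OF assms] closure_subset by (auto simp: Union_mesh)
    then show "x \<in> ext_region M i" using x by (auto simp: ext_region_def)
  qed
qed

lemma open_subdom: "i \<in> {1, 2} \<Longrightarrow> open (subdom M i)"
  using partition by (auto simp: partition_of_def)

lemma interface_subset: "i \<in> {1, 2} \<Longrightarrow> interface M \<subseteq> ext_region M i"
  using closure_subdom_subset by (auto simp: interface_def)

lemma domain_subset_ext: "\<Omega> \<subseteq> ext_region M 1 \<union> ext_region M 2"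
proof -
  have "\<Omega> = subdom M 1 \<union> subdom M 2 \<union> (interface M \<inter> \<Omega>)"
    using partition by (simp add: partition_of_def)
  then show ?thesis
    using closure_subdom_subset[of 1] closure_subdom_subset[of 2] closure_subset interface_subset[of 1]
    by blast
qed

section \<open>Linear structure of V_h\<close>

lemma Vh_polyE:
  assumes "u \<in> Vh k \<Omega> M" "T \<in> mesh M"
  obtains p where "poly_fun k p" "\<And>x. x \<in> T \<Longrightarrow> u x = p x"
  using assms by (auto simp: Vh_def)

lemma Vh_add:
  assumes "u \<in> Vh k \<Omega> M" "v \<in> Vh k \<Omega> M"
  shows "(\<lambda>x. u x + v x) \<in> Vh k \<Omega> M"
proof -
  have "\<exists>p. poly_fun k p \<and> (\<forall>x\<in>T. u x + v x = p x)" if T: "T \<in> mesh M" for T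
  proof -
    obtain p where p: "poly_fun k p" "\<And>x. x \<in> T \<Longrightarrow> u x = p x" using Vh_polyE[OF assms(1) T] by blast
    obtain q where q: "poly_fun k q" "\<And>x. x \<in> T \<Longrightarrow> v x = q x" using Vh_polyE[OF assms(2) T] by blast
    show ?thesis by (rule exI[of _ "\<lambda>x. p x + q x"]) (simp add: p q poly_fun_add)
  qed
  then show ?thesis using assms by (simp add: Vh_def continuous_on_add)
qed

lemma Vh_scale:
  assumes "u \<in> Vh k \<Omega> M"
  shows "(\<lambda>x. c * u x) \<in> Vh k \<Omega> M"
proof -
  have "\<exists>p. poly_fun k p \<and> (\<forall>x\<in>T. c * u x = p x)" if T: "T \<in> mesh M" for T
  proof -
    obtain p where p: "poly_fun k p" "\<And>x. x \<in> T \<Longrightarrow> u x = p x" using Vh_polyE[OF assms(1) T] by blast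
    show ?thesis by (rule exI[of _ "\<lambda>x. c * p x"]) (simp add: p poly_fun_scale)
  qed
  then show ?thesis using assms by (simp add: Vh_def continuous_on_mult_left)
qed

lemma Vh_0: "(\<lambda>x. 0) \<in> Vh k \<Omega> M"
  unfolding Vh_def using poly_fun_0 by auto

lemma Vh_sum:
  "(\<And>j. j \<in> J \<Longrightarrow> h j \<in> Vh k \<Omega> M) \<Longrightarrow> (\<lambda>y. \<Sum>j\<in>J. x j * h j y) \<in> Vh k \<Omega> M"
  by (induction J rule: infinite_finite_induct) (auto intro!: Vh_0 Vh_add Vh_scale)

text \<open>Linearity is asked for only on V_h, where the integrals behind \<open>f\<close> are
  known to exist.\<close>

lemma Vh_linear_sum:
  fixes f :: "('a \<Rightarrow> real) \<Rightarrow> real"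
  assumes add: "\<And>u v. u \<in> Vh k \<Omega> M \<Longrightarrow> v \<in> Vh k \<Omega> M \<Longrightarrow> f (\<lambda>x. u x + v x) = f u + f v"
    and scale: "\<And>c u. u \<in> Vh k \<Omega> M \<Longrightarrow> f (\<lambda>x. c * u x) = c * f u"
    and h: "\<And>j. j \<in> J \<Longrightarrow> h j \<in> Vh k \<Omega> M"
  shows "f (\<lambda>y. \<Sum>j\<in>J. x j * h j y) = (\<Sum>j\<in>J. x j * f (h j))"
proof -
  have f0: "f (\<lambda>y. 0) = 0" using scale[OF Vh_0, of 0] by simp
  show ?thesis
    using h
  proof (induction J rule: infinite_finite_induct)
    case (insert j J)
    have "f (\<lambda>y. x j * h j y + (\<Sum>j\<in>J. x j * h j y)) = f (\<lambda>y. x j * h j y) + f (\<lambda>y. \<Sum>j\<in>J. x j * h j y)"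
      using insert.prems by (intro add Vh_scale Vh_sum) auto
    then show ?case using insert by (simp add: scale)
  qed (simp_all add: f0)
qed

section \<open>Gradients and their integrals off the skeleton\<close>

lemma grad_on_poly:
  assumes "T \<in> mesh M" "x \<in> interior T" "\<And>y. y \<in> T \<Longrightarrow> u y = p y" "poly_fun k p"
  shows "grad_on UNIV u x = grad_on UNIV p x" "u differentiable at x"
proof -
  have "u y = p y" if "y \<in> interior T" for y
    using that interior_subset assms(3) by blast
  then show "grad_on UNIV u x = grad_on UNIV p x" "u differentiable at x"
    using grad_on_locally_eq[OF open_interior assms(2) subset_UNIV, of u p] differentiable_poly_fun[OF assms(4)]
    by blast+
qed

lemma Vh_differentiable:
  assumes "u \<in> Vh k \<Omega> M" "x \<in> core"
  shows "u differentiable at x"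
proof -
  obtain T where T: "T \<in> mesh M" "x \<in> interior T" using assms(2) by (auto simp: core_def)
  obtain p where "poly_fun k p" "\<And>y. y \<in> T \<Longrightarrow> u y = p y" using Vh_polyE[OF assms(1) T(1)] by blast
  then show ?thesis using grad_on_poly[OF T] by blast
qed

text \<open>Common integrand for subdomains, extended regions and \<Omega>; it is integrated only
  over subsets of \<open>core\<close>, where gradients are genuine.\<close>

definition gdot :: "('a \<Rightarrow> real) \<Rightarrow> ('a \<Rightarrow> real) \<Rightarrow> 'a \<Rightarrow> real" where
  "gdot u v x = grad_on UNIV u x \<bullet> grad_on UNIV v x"

lemma gdot_integrable_core:
  assumes "u \<in> Vh k \<Omega> M" "v \<in> Vh k \<Omega> M"
  shows "set_integrable lebesgue core (gdot u v)"
  unfolding core_def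
proof (rule set_integrable_UN[OF finite_mesh])
  fix T assume T: "T \<in> mesh M"
  obtain p where p: "poly_fun k p" "\<And>y. y \<in> T \<Longrightarrow> u y = p y" using Vh_polyE[OF assms(1) T] by blast
  obtain q where q: "poly_fun k q" "\<And>y. y \<in> T \<Longrightarrow> v y = q y" using Vh_polyE[OF assms(2) T] by blast
  have "set_integrable lebesgue (interior T) (\<lambda>x. grad_on UNIV p x \<bullet> grad_on UNIV q x)"
    using p(1) q(1) mesh_compact[OF T]
    by (intro set_integrable_lebesgue_continuous continuous_on_inner continuous_on_grad_poly_fun)
       (auto intro: bounded_subset[OF compact_imp_bounded interior_subset])
  moreover have "gdot u v x = grad_on UNIV p x \<bullet> grad_on UNIV q x" if "x \<in> interior T" for x
    using grad_on_poly(1)[OF T that p(2,1)] grad_on_poly(1)[OF T that q(2,1)] by (simp add: gdot_def)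
  ultimately show "set_integrable lebesgue (interior T) (gdot u v)"
    by (simp cong: set_integrable_cong)
qed simp

lemma gdot_integrable:
  assumes "u \<in> Vh k \<Omega> M" "v \<in> Vh k \<Omega> M" "open U"
  shows "set_integrable lebesgue (U \<inter> core) (gdot u v)"
  using gdot_integrable_core[OF assms(1,2)] assms(3) open_core
  by (rule_tac set_integrable_subset) auto

lemma gdot_add:
  assumes "u \<in> Vh k \<Omega> M" "v \<in> Vh k \<Omega> M" "x \<in> core"
  shows "gdot (\<lambda>y. u y + v y) w x = gdot u w x + gdot v w x"
  using assms by (simp add: gdot_def grad_on_add Vh_differentiable inner_add_left)

lemma gdot_scale:
  assumes "u \<in> Vh k \<Omega> M" "x \<in> core"
  shows "gdot (\<lambda>y. c * u y) w x = c * gdot u w x"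
  using assms by (simp add: gdot_def grad_on_scale Vh_differentiable)

text \<open>On the skeleton \<open>f\<close> may take unspecified values. The part of
  \<open>S\<close> outside \<open>interior S \<inter> core\<close> is negligible, and passing
  through the gauge integral drops it without any measurability of \<open>f\<close> on it.\<close>

lemma set_integral_core:
  assumes S: "S \<subseteq> closure \<Omega>" "S \<inter> core \<subseteq> interior S"
    and g: "set_integrable lebesgue (interior S \<inter> core) g"
    and eq: "\<And>x. x \<in> interior S \<inter> core \<Longrightarrow> f x = g x"
  shows "(LINT x:S|lebesgue. f x) = (LINT x:interior S \<inter> core|lebesgue. (g x :: real))"
proof -
  let ?I = "interior S \<inter> core"
  have I: "?I \<subseteq> S" "S - ?I \<subseteq> closure \<Omega> - core" using S interior_subset by auto
  have neg: "negligible (S - ?I)" by (rule negligible_subset[OF negligible_off_core I(2)])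
  have fI: "set_integrable lebesgue ?I f" using g set_integrable_cong[OF refl refl eq, of "?I"] by simp
  have n1: "negligible {x \<in> ?I - S. f x \<noteq> 0}" "negligible {x \<in> S - ?I. f x \<noteq> 0}"
    using I(1) by (auto intro: negligible_subset[OF neg] simp: empty_imp_negligible)
  have fS: "set_integrable lebesgue S f"
    using fI absolutely_integrable_spike_set_eq[OF n1] by simp
  have "(LINT x:S|lebesgue. f x) = integral S f"
    by (rule set_lebesgue_integral_eq_integral(2)[OF fS])
  also have "\<dots> = integral ?I f" by (rule integral_spike_set[OF n1(2,1)])
  also have "\<dots> = (LINT x:?I|lebesgue. f x)"
    by (rule set_lebesgue_integral_eq_integral(2)[OF fI, symmetric])
  also have "\<dots> = (LINT x:?I|lebesgue. g x)"
    using eq open_core by (intro set_lebesgue_integral_cong) auto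
  finally show ?thesis .
qed

lemma grad_on_core:
  assumes "x \<in> interior S \<inter> core" "u \<in> Vh k \<Omega> M" "\<And>y. y \<in> S \<Longrightarrow> f y = u y"
  shows "grad_on S f x = grad_on UNIV u x"
  using assms interior_subset
  by (intro grad_on_locally_eq(1)[of "interior S \<inter> core"]) (auto simp: open_core Vh_differentiable)

text \<open>The second condition on \<open>S\<close> says that its boundary avoids
  \<open>core\<close>; it covers open sets as well as the closed extended regions.\<close>

lemma grad_ip_core:
  assumes S: "S \<subseteq> closure \<Omega>" "S \<inter> core \<subseteq> interior S"
    and u: "u \<in> Vh k \<Omega> M" "\<And>y. y \<in> S \<Longrightarrow> f y = u y"
    and v: "v \<in> Vh k \<Omega> M" "\<And>y. y \<in> S \<Longrightarrow> g y = v y"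
  shows "grad_ip S f g = (LINT x:interior S \<inter> core|lebesgue. gdot u v x)"
  unfolding grad_ip_def
proof (rule set_integral_core[OF S])
  show "set_integrable lebesgue (interior S \<inter> core) (gdot u v)"
    by (rule gdot_integrable[OF u(1) v(1) open_interior])
  show "grad_on S f x \<bullet> grad_on S g x = gdot u v x" if "x \<in> interior S \<inter> core" for x
    using grad_on_core[OF that u] grad_on_core[OF that v] by (simp add: gdot_def)
qed


section \<open>Nodal expansions and the image of (u, 0)\<close>

lemma finite_nodes: "finite (I0 k \<Omega> M)"
  unfolding I0_def using finite_mesh finite_lagrange_nodes[OF mesh_simplex] by blast

lemma hat_Vh: "j \<in> I0 k \<Omega> M \<Longrightarrow> hat M j \<in> Vh k \<Omega> M"
  using basis by (simp add: nodal_basis_def)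

lemma fe_fun_Vh: "fe_fun k \<Omega> M x \<in> Vh k \<Omega> M"
  unfolding fe_fun_def by (rule Vh_sum) (rule hat_Vh)

lemma cut_comb_node:
  assumes "j \<in> Icut k \<Omega> M"
  shows "cut_comb M (Icut k \<Omega> M) b j = b j"
proof -
  have "cut_comb M (Icut k \<Omega> M) b j = (\<Sum>i\<in>Icut k \<Omega> M. if i = j then b i else 0)"
    unfolding cut_comb_def
    using assms basis by (intro sum.cong) (auto simp: cut_hat_def restr0_def Icut_def nodal_basis_def)
  also have "\<dots> = b j"
    using assms finite_subset[OF _ finite_nodes, of "Icut k \<Omega> M"] by (simp add: Icut_def)
  finally show ?thesis .
qed

text \<open>Evaluation at nodes forces the chosen coefficients to vanish on \<open>Icut\<close>;
  elsewhere they are arbitrary, but \<open>Icut_i\<close> is a part of \<open>Icut\<close>.\<close>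

lemma Qcut_0: "Qcut k \<Omega> M i (\<lambda>_. 0) = (\<lambda>_. 0)"
proof -
  define b where "b = (SOME b. (\<lambda>_. 0) = cut_comb M (Icut k \<Omega> M) b)"
  have "(\<lambda>_. 0) = cut_comb M (Icut k \<Omega> M) (\<lambda>_. 0)" by (simp add: cut_comb_def)
  then have "(\<lambda>_. 0) = cut_comb M (Icut k \<Omega> M) b" unfolding b_def by (rule someI[of "\<lambda>b. (\<lambda>_. 0) = cut_comb M (Icut k \<Omega> M) b"])
  then have "b j = 0" if "j \<in> Icut k \<Omega> M" for j using cut_comb_node[OF that, of b] by metis
  then have "cut_comb M (Icut_i k \<Omega> M i) b = (\<lambda>_. 0)"
    by (auto simp: cut_comb_def Icut_i_def)
  then show ?thesis by (simp add: Qcut_def b_def)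
qed

lemma Lmap_0: "Lmap k \<Omega> M (u, \<lambda>_. 0) = (\<lambda>i. restr0 (ext_region M i) u)"
  by (simp add: Lmap_def Qcut_0)

text \<open>Makes the assumed norm equivalence applicable to pairs (u, 0).\<close>

lemma zero_in_Vcut: "(\<lambda>_. 0) \<in> Vcut k \<Omega> M"
proof -
  have "(\<lambda>_. 0) \<in> Vcut_i k \<Omega> M i" for i
    unfolding Vcut_i_def by (rule range_eqI[of _ _ "\<lambda>_. 0"]) (simp add: cut_comb_def)
  then show ?thesis unfolding Vcut_def by force
qed

lemma jump_Lmap_0: "x \<in> interface M \<Longrightarrow> jump (Lmap k \<Omega> M (u, \<lambda>_. 0)) x = 0"
  using interface_subset[of 1] interface_subset[of 2] by (auto simp: Lmap_0 jump_def restr0_def)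

text \<open>The jump of the first argument is 0 at every point of the interface, so the truncated
  integrand is identically 0 whatever value the averaged flux has.\<close>

lemma Nc_Lmap_0: "Nc \<alpha> M w (Lmap k \<Omega> M (u, \<lambda>_. 0)) = 0"
  if "w = Lmap k \<Omega> M (v, \<lambda>_. 0)"
proof -
  have "(\<lambda>x. indicator (interface M) x *\<^sub>R (c x * jump w x)) = (\<lambda>x. 0 :: real)" for c
    using jump_Lmap_0 that by (auto simp: indicator_def)
  then show ?thesis by (simp add: Nc_def set_lebesgue_integral_def)
qed

lemma hinv_ip_Lmap_0: "hinv_ip M (jump (Lmap k \<Omega> M (u, \<lambda>_. 0))) w = 0"
proof -
  have "(\<lambda>x. indicator (T \<inter> interface M) x *\<^sub>R (jump (Lmap k \<Omega> M (u, \<lambda>_. 0)) x * w x)) = (\<lambda>x. 0 :: real)" for T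
    using jump_Lmap_0 by (auto simp: indicator_def)
  then show ?thesis by (simp add: hinv_ip_def set_lebesgue_integral_def)
qed

lemma grad_ip_subdom:
  assumes "i \<in> {1, 2}" "u \<in> Vh k \<Omega> M" "v \<in> Vh k \<Omega> M"
  shows "grad_ip (subdom M i) (restr0 (ext_region M i) u) (restr0 (ext_region M i) v) =
    (LINT x:subdom M i \<inter> core|lebesgue. gdot u v x)"
proof -
  have int: "interior (subdom M i) = subdom M i" using open_subdom[OF assms(1)] by (simp add: interior_open)
  have sub: "subdom M i \<subseteq> ext_region M i" using closure_subdom_subset[OF assms(1)] closure_subset by blast
  have "grad_ip (subdom M i) (restr0 (ext_region M i) u) (restr0 (ext_region M i) v) =
      (LINT x:interior (subdom M i) \<inter> core|lebesgue. gdot u v x)"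
    using assms(2,3) sub subdom_subset[OF assms(1)] closure_subset[of \<Omega>]
    by (intro grad_ip_core) (auto simp: int restr0_def)
  then show ?thesis by (simp add: int)
qed

lemma grad_ip_ext_region:
  assumes "u \<in> Vh k \<Omega> M" "v \<in> Vh k \<Omega> M"
  shows "grad_ip (ext_region M i) (restr0 (ext_region M i) u) (restr0 (ext_region M i) v) =
    (LINT x:interior (ext_region M i) \<inter> core|lebesgue. gdot u v x)"
  using assms by (intro grad_ip_core ext_region_subset ext_region_core) (auto simp: restr0_def)

lemma open_domain: "open \<Omega>"
  using open_interior[of "closure \<Omega>"] by (simp add: regular_open)

lemma grad_ip_domain:
  assumes "u \<in> Vh k \<Omega> M" "v \<in> Vh k \<Omega> M"
  shows "grad_ip \<Omega> u v = (LINT x:core|lebesgue. gdot u v x)"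
proof -
  have "interior \<Omega> \<inter> core = core" using core_subset open_domain by (auto simp: interior_open)
  then show ?thesis
    using grad_ip_core[of \<Omega> u u v v] assms closure_subset open_domain by (auto simp: interior_open)
qed

section \<open>Face jumps and the ghost penalty\<close>

lemma face_sides_ghost:
  assumes "i \<in> {1, 2}" "F \<in> ghost M i"
  obtains T T' where "face_sides M F = (T, T')" "T \<in> mesh M" "T' \<in> mesh M"
    "F facet_of T" "F facet_of T'" "T \<subseteq> ext_region M i" "T' \<subseteq> ext_region M i"
proof -
  obtain S S' where S: "S \<in> mesh M" "S' \<in> mesh M" "S \<noteq> S'" "F facet_of S" "F facet_of S'"
      "S \<inter> subdom M i \<noteq> {}" "S' \<inter> subdom M i \<noteq> {}"
    using ghost assms unfolding ghost_faces_def by meson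
  obtain T T' where TT: "face_sides M F = (T, T')" by (cases "face_sides M F")
  \<comment> \<open>The choice asks only for two distinct simplices with facet \<open>F\<close>. As
    \<open>S\<close> and \<open>S'\<close> are two such simplices meeting the subdomain, and
    \<open>facet_shared_by_two\<close> admits no third, the chosen ones are among them.\<close>
  have "case face_sides M F of (T, T') \<Rightarrow>
      T \<in> mesh M \<and> T' \<in> mesh M \<and> T \<noteq> T' \<and> F facet_of T \<and> F facet_of T'"
    unfolding face_sides_def by (rule someI[of _ "(S, S')"]) (simp add: S)
  then have T: "T \<in> mesh M" "T' \<in> mesh M" "F facet_of T" "F facet_of T'" by (simp_all add: TT)
  have tri: "triangulation (mesh M)" using mesh by (simp add: mesh_of_def)
  have "U \<subseteq> ext_region M i" if U: "U \<in> mesh M" "F facet_of U" for U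
  proof -
    have "U = S \<or> U = S'"
      using facet_shared_by_two[OF tri U(1) S(1,2) mesh_interior mesh_interior mesh_interior U(2) S(4,5)] U S
      by blast
    then show ?thesis using S mesh_subset_ext_region by blast
  qed
  then show ?thesis using that[OF TT] T by blast
qed

lemma poly_piece_Vh:
  assumes "u \<in> Vh k \<Omega> M" "T \<in> mesh M" "T \<subseteq> S"
  shows "poly_fun k (poly_piece k T (restr0 S u))" "\<And>x. x \<in> T \<Longrightarrow> poly_piece k T (restr0 S u) x = u x"
proof -
  obtain p where "poly_fun k p" "\<And>x. x \<in> T \<Longrightarrow> u x = p x" using Vh_polyE[OF assms(1,2)] by blast
  then have "poly_fun k p \<and> (\<forall>x\<in>T. restr0 S u x = p x)" using assms(3) by (auto simp: restr0_def)
  then have *: "poly_fun k (poly_piece k T (restr0 S u)) \<and> (\<forall>x\<in>T. restr0 S u x = poly_piece k T (restr0 S u) x)"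
    unfolding poly_piece_def by (rule someI[of "\<lambda>p. poly_fun k p \<and> (\<forall>x\<in>T. restr0 S u x = p x)"])
  show "poly_fun k (poly_piece k T (restr0 S u))" using * by blast
  show "poly_piece k T (restr0 S u) x = u x" if "x \<in> T" for x
  proof -
    have "restr0 S u x = u x" using that assms(3) by (auto simp: restr0_def)
    then show ?thesis using * that by simp
  qed
qed

text \<open>Both sides are polynomials with the same values on \<open>T\<close>, which has interior
  points; uniqueness turns the choice into a linear operation.\<close>

lemma poly_piece_add:
  assumes "u \<in> Vh k \<Omega> M" "v \<in> Vh k \<Omega> M" "T \<in> mesh M" "T \<subseteq> S"
  shows "poly_piece k T (restr0 S (\<lambda>x. u x + v x)) =
    (\<lambda>x. poly_piece k T (restr0 S u) x + poly_piece k T (restr0 S v) x)"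
  by (rule poly_fun_eqI[of k _ _ T])
     (simp_all add: poly_piece_Vh assms Vh_add mesh_interior poly_fun_add)

lemma poly_piece_scale:
  assumes "u \<in> Vh k \<Omega> M" "T \<in> mesh M" "T \<subseteq> S"
  shows "poly_piece k T (restr0 S (\<lambda>x. c * u x)) = (\<lambda>x. c * poly_piece k T (restr0 S u) x)"
  by (rule poly_fun_eqI[of k _ _ T])
     (simp_all add: poly_piece_Vh assms Vh_scale mesh_interior poly_fun_scale)

abbreviation fjump :: "nat \<Rightarrow> nat \<Rightarrow> 'a set \<Rightarrow> ('a \<Rightarrow> real) \<Rightarrow> 'a \<Rightarrow> real" where
  "fjump i l F u \<equiv> face_jump k M l F (restr0 (ext_region M i) u)"

lemma fjump_add:
  assumes "i \<in> {1, 2}" "F \<in> ghost M i" "u \<in> Vh k \<Omega> M" "v \<in> Vh k \<Omega> M"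
  shows "fjump i l F (\<lambda>x. u x + v x) x = fjump i l F u x + fjump i l F v x"
  using assms
  by (elim face_sides_ghost[of i F])
     (simp_all add: face_jump_def poly_piece_add dir_deriv_add[OF poly_piece_Vh(1) poly_piece_Vh(1)])

lemma fjump_scale:
  assumes "i \<in> {1, 2}" "F \<in> ghost M i" "u \<in> Vh k \<Omega> M"
  shows "fjump i l F (\<lambda>x. c * u x) x = c * fjump i l F u x"
  using assms
  by (elim face_sides_ghost[of i F])
     (simp_all add: face_jump_def poly_piece_scale dir_deriv_scale[OF poly_piece_Vh(1)] algebra_simps)

lemma fjump_continuous:
  assumes "i \<in> {1, 2}" "F \<in> ghost M i" "u \<in> Vh k \<Omega> M"
  shows "continuous_on UNIV (fjump i l F u)"
proof -
  obtain T T' where T: "face_sides M F = (T, T')" "T \<in> mesh M" "T' \<in> mesh M"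
      "T \<subseteq> ext_region M i" "T' \<subseteq> ext_region M i"
    using face_sides_ghost[OF assms(1,2)] by metis
  show ?thesis
    unfolding face_jump_def T(1) fst_conv snd_conv
    using T assms(3) by (intro continuous_on_diff continuous_on_dir_deriv[where k = k] poly_piece_Vh)
qed

text \<open>Needed to split the integral of a sum in \<open>Gh_add\<close>. A facet is a compact
  part of a hyperplane, hence of finite measure, and the jumps are continuous.\<close>

lemma fjump_integrable:
  assumes "i \<in> {1, 2}" "F \<in> ghost M i" "u \<in> Vh k \<Omega> M" "v \<in> Vh k \<Omega> M"
  shows "set_integrable surface_measure F (\<lambda>x. fjump i l F u x * fjump i l F v x)"
proof -
  obtain T where T: "T \<in> mesh M" "F facet_of T" using face_sides_ghost[OF assms(1,2)] by metis
  obtain a b where ab: "a \<noteq> 0" "affine hull F = {x. a \<bullet> x = b}"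
    using facet_affine_hull[OF T(2) mesh_interior[OF T(1)]] by metis
  have "compact F"
    using T mesh_compact mesh_convex face_of_imp_compact by (auto simp: facet_of_def)
  moreover have "F \<subseteq> {x. a \<bullet> x = b}" using ab(2) hull_subset[of F affine] by simp
  ultimately show ?thesis
    using ab(1) dim_ge_2 assms
    by (intro set_integrable_surface_hyperplane continuous_on_mult fjump_continuous)
qed

lemma Gh_add:
  assumes "u \<in> Vh k \<Omega> M" "v \<in> Vh k \<Omega> M" "w \<in> Vh k \<Omega> M"
  shows "Gh k \<beta> M (\<lambda>i. restr0 (ext_region M i) (\<lambda>x. u x + v x)) (\<lambda>i. restr0 (ext_region M i) w) =
    Gh k \<beta> M (\<lambda>i. restr0 (ext_region M i) u) (\<lambda>i. restr0 (ext_region M i) w) +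
    Gh k \<beta> M (\<lambda>i. restr0 (ext_region M i) v) (\<lambda>i. restr0 (ext_region M i) w)"
proof -
  have eq: "(LINT x:F|surface_measure. fjump i l F (\<lambda>x. u x + v x) x * fjump i l F w x) =
      (LINT x:F|surface_measure. fjump i l F u x * fjump i l F w x) +
      (LINT x:F|surface_measure. fjump i l F v x * fjump i l F w x)"
    if "i \<in> {1, 2}" "F \<in> ghost M i" for i F l
    using that assms by (simp add: fjump_add distrib_right set_integral_add(2) fjump_integrable)
  show ?thesis
    unfolding Gh_def distrib_left[symmetric] sum.distrib[symmetric]
    by (intro arg_cong2[where f = "(*)"] refl sum.cong) (simp only: eq distrib_left)
qed

text \<open>Constants leave a Bochner integral without integrability, so \<open>w\<close> may be any
  function here.\<close>

lemma Gh_scale: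
  assumes "u \<in> Vh k \<Omega> M"
  shows "Gh k \<beta> M (\<lambda>i. restr0 (ext_region M i) (\<lambda>x. c * u x)) (\<lambda>i. restr0 (ext_region M i) w) =
    c * Gh k \<beta> M (\<lambda>i. restr0 (ext_region M i) u) (\<lambda>i. restr0 (ext_region M i) w)"
proof -
  have eq: "d * (LINT x:F|surface_measure. fjump i l F (\<lambda>x. c * u x) x * fjump i l F w x) =
      c * (d * (LINT x:F|surface_measure. fjump i l F u x * fjump i l F w x))"
    if "i \<in> {1, 2}" "F \<in> ghost M i" for i F l d
    using that assms by (simp add: fjump_scale mult.assoc)
  show ?thesis
    unfolding Gh_def mult.left_commute[of c \<beta>] sum_distrib_left[of c]
    by (intro arg_cong2[where f = "(*)"] refl sum.cong eq)
qed

lemma Gh_commute: "Gh k \<beta> M u v = Gh k \<beta> M v u"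
  by (simp add: Gh_def mult.commute)

section \<open>Bilinearity on pairs (u, 0) and the quadratic form of the matrix\<close>

lemma Ahat_0:
  assumes "u \<in> Vh k \<Omega> M" "v \<in> Vh k \<Omega> M"
  shows "Ahat k \<Omega> \<alpha> \<alpha>bar \<gamma> \<beta> M (u, \<lambda>_. 0) (v, \<lambda>_. 0) =
    (\<Sum>i\<in>{1, 2}. \<alpha> i * (LINT x:subdom M i \<inter> core|lebesgue. gdot u v x)) +
    Gh k \<beta> M (\<lambda>i. restr0 (ext_region M i) u) (\<lambda>i. restr0 (ext_region M i) v)"
proof -
  have "(\<Sum>i\<in>{1, 2}. \<alpha> i * grad_ip (subdom M i) (restr0 (ext_region M i) u) (restr0 (ext_region M i) v)) =
      (\<Sum>i\<in>{1, 2}. \<alpha> i * (LINT x:subdom M i \<inter> core|lebesgue. gdot u v x))"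
    using assms by (intro sum.cong refl) (simp only: grad_ip_subdom)
  then show ?thesis
    unfolding Ahat_def Ah_def Nc_Lmap_0[OF refl] hinv_ip_Lmap_0 by (simp add: Lmap_0)
qed

lemma Ahat_0_add:
  assumes "u \<in> Vh k \<Omega> M" "v \<in> Vh k \<Omega> M" "w \<in> Vh k \<Omega> M"
  shows "Ahat k \<Omega> \<alpha> \<alpha>bar \<gamma> \<beta> M (\<lambda>x. u x + v x, \<lambda>_. 0) (w, \<lambda>_. 0) =
    Ahat k \<Omega> \<alpha> \<alpha>bar \<gamma> \<beta> M (u, \<lambda>_. 0) (w, \<lambda>_. 0) + Ahat k \<Omega> \<alpha> \<alpha>bar \<gamma> \<beta> M (v, \<lambda>_. 0) (w, \<lambda>_. 0)"
proof -
  have "(LINT x:subdom M i \<inter> core|lebesgue. gdot (\<lambda>x. u x + v x) w x) =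
      (LINT x:subdom M i \<inter> core|lebesgue. gdot u w x) + (LINT x:subdom M i \<inter> core|lebesgue. gdot v w x)"
    if i: "i \<in> {1, 2}" for i
  proof -
    have "(LINT x:subdom M i \<inter> core|lebesgue. gdot (\<lambda>x. u x + v x) w x) =
        (LINT x:subdom M i \<inter> core|lebesgue. gdot u w x + gdot v w x)"
      using open_subdom[OF i] open_core assms
      by (intro set_lebesgue_integral_cong) (auto simp: gdot_add)
    also have "\<dots> = (LINT x:subdom M i \<inter> core|lebesgue. gdot u w x) +
        (LINT x:subdom M i \<inter> core|lebesgue. gdot v w x)"
      using open_subdom[OF i] assms by (intro set_integral_add(2) gdot_integrable)
    finally show ?thesis .
  qed
  then show ?thesis
    using assms by (simp add: Ahat_0 Vh_add Gh_add distrib_left)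
qed

lemma Ahat_0_scale:
  assumes "u \<in> Vh k \<Omega> M" "w \<in> Vh k \<Omega> M"
  shows "Ahat k \<Omega> \<alpha> \<alpha>bar \<gamma> \<beta> M (\<lambda>x. c * u x, \<lambda>_. 0) (w, \<lambda>_. 0) =
    c * Ahat k \<Omega> \<alpha> \<alpha>bar \<gamma> \<beta> M (u, \<lambda>_. 0) (w, \<lambda>_. 0)"
proof -
  have "(LINT x:subdom M i \<inter> core|lebesgue. gdot (\<lambda>x. c * u x) w x) =
      (LINT x:subdom M i \<inter> core|lebesgue. c * gdot u w x)"
    if i: "i \<in> {1, 2}" for i
    using open_subdom[OF i] open_core assms
    by (intro set_lebesgue_integral_cong) (auto simp: gdot_scale)
  then show ?thesis
    using assms by (simp add: Ahat_0 Vh_scale Gh_scale distrib_left mult.left_commute[of c])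
qed

text \<open>Carries linearity from the first argument over to the second.\<close>

lemma Ahat_0_commute:
  assumes "u \<in> Vh k \<Omega> M" "w \<in> Vh k \<Omega> M"
  shows "Ahat k \<Omega> \<alpha> \<alpha>bar \<gamma> \<beta> M (u, \<lambda>_. 0) (w, \<lambda>_. 0) = Ahat k \<Omega> \<alpha> \<alpha>bar \<gamma> \<beta> M (w, \<lambda>_. 0) (u, \<lambda>_. 0)"
  using assms Gh_commute by (simp add: Ahat_0 gdot_def inner_commute)

text \<open>The second argument is expanded in the index \<open>m\<close>, by symmetry, and then the
  first in \<open>l\<close>; this matches the order of arguments in \<open>A0\<close>.\<close>

lemma quad_form_A0:
  "quad_form (I0 k \<Omega> M) (A0 k \<Omega> \<alpha> \<alpha>bar \<gamma> \<beta> M) x =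
    Ahat k \<Omega> \<alpha> \<alpha>bar \<gamma> \<beta> M (fe_fun k \<Omega> M x, \<lambda>_. 0) (fe_fun k \<Omega> M x, \<lambda>_. 0)"
proof -
  let ?a = "\<lambda>u v. Ahat k \<Omega> \<alpha> \<alpha>bar \<gamma> \<beta> M (u, \<lambda>_. 0) (v, \<lambda>_. 0)"
  let ?u = "fe_fun k \<Omega> M x"
  have lin: "?a ?u v = (\<Sum>j\<in>I0 k \<Omega> M. x j * ?a (hat M j) v)" if v: "v \<in> Vh k \<Omega> M" for v
    unfolding fe_fun_def
    by (rule Vh_linear_sum[of "\<lambda>u. ?a u v"]) (simp_all add: Ahat_0_add Ahat_0_scale v hat_Vh)
  have "?a ?u ?u = (\<Sum>m\<in>I0 k \<Omega> M. x m * ?a ?u (hat M m))"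
    by (simp add: lin[OF fe_fun_Vh] Ahat_0_commute[OF fe_fun_Vh hat_Vh])
  also have "\<dots> = (\<Sum>m\<in>I0 k \<Omega> M. \<Sum>l\<in>I0 k \<Omega> M. x m * ?a (hat M l) (hat M m) * x l)"
    by (simp add: lin[OF hat_Vh] sum_distrib_left mult_ac)
  finally show ?thesis by (simp add: quad_form_def A0_def)
qed

section \<open>Bounds of energy and diffusion form by the gradient norm\<close>

lemma energy_equiv_grad_ip:
  assumes u: "u \<in> Vh k \<Omega> M"
  shows "grad_ip \<Omega> u u \<le> energy k \<Omega> M (u, \<lambda>_. 0)" "energy k \<Omega> M (u, \<lambda>_. 0) \<le> 2 * grad_ip \<Omega> u u"
proof -
  let ?g = "gdot u u"
  define E where "E i = interior (ext_region M i) \<inter> core" for i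
  have g0: "?g x \<ge> 0" for x by (simp add: gdot_def)
  have E: "E i \<in> sets lebesgue" "E i \<subseteq> core" for i using open_core by (auto simp: E_def)
  have gE: "set_integrable lebesgue (E i) ?g" for i
    unfolding E_def by (rule gdot_integrable[OF u u open_interior])
  have gc: "set_integrable lebesgue core ?g" by (rule gdot_integrable_core[OF u u])
  have energy: "energy k \<Omega> M (u, \<lambda>_. 0) = (LINT x:E 1|lebesgue. ?g x) + (LINT x:E 2|lebesgue. ?g x)"
    by (simp add: energy_def Let_def hinv_ip_Lmap_0[unfolded Lmap_0] Lmap_0 grad_ip_ext_region u E_def)
  have "(LINT x:E i|lebesgue. ?g x) \<le> (LINT x:core|lebesgue. ?g x)" for i
    unfolding set_lebesgue_integral_def
    using gE[of i] gc g0 E(2)[of i]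
    by (intro integral_mono) (auto simp: set_integrable_def indicator_def)
  from this[of 1] this[of 2] show "energy k \<Omega> M (u, \<lambda>_. 0) \<le> 2 * grad_ip \<Omega> u u"
    by (simp add: energy grad_ip_domain u)
  \<comment> \<open>By \<open>ext_region_core\<close>, a point of \<open>core\<close> in an extended
    region is interior to it.\<close>
  have cE: "core \<subseteq> E 1 \<union> E 2"
    using domain_subset_ext core_subset ext_region_core by (fastforce simp: E_def)
  have "(LINT x:core|lebesgue. ?g x) \<le>
      (LINT x|lebesgue. indicator (E 1) x *\<^sub>R ?g x + indicator (E 2) x *\<^sub>R ?g x)"
    unfolding set_lebesgue_integral_def
    using gE[of 1] gE[of 2] gc g0 cE
    by (intro integral_mono) (auto simp: set_integrable_def indicator_def)
  also have "\<dots> = (LINT x:E 1|lebesgue. ?g x) + (LINT x:E 2|lebesgue. ?g x)"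
    using gE[of 1] gE[of 2] by (simp add: set_integrable_def set_lebesgue_integral_def)
  finally show "grad_ip \<Omega> u u \<le> energy k \<Omega> M (u, \<lambda>_. 0)"
    by (simp add: energy grad_ip_domain u)
qed

lemma diffusion_equiv_grad_ip:
  assumes u: "u \<in> Vh k \<Omega> M"
  shows "min (\<alpha> 1) (\<alpha> 2) * grad_ip \<Omega> u u \<le> diffusion_ip \<Omega> \<alpha> M u u"
    and "diffusion_ip \<Omega> \<alpha> M u u \<le> max (\<alpha> 1) (\<alpha> 2) * grad_ip \<Omega> u u"
proof -
  let ?g = "gdot u u"
  define a where "a x = (if x \<in> subdom M 1 then \<alpha> 1 else \<alpha> 2)" for x
  have g0: "?g x \<ge> 0" for x by (simp add: gdot_def)
  have gc: "set_integrable lebesgue core ?g" by (rule gdot_integrable_core[OF u u])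
  have g1: "set_integrable lebesgue (subdom M 1 \<inter> core) ?g"
    using open_subdom[of 1] by (intro gdot_integrable u) simp
  have "set_integrable lebesgue core (\<lambda>x. a x * ?g x)"
  proof -
    \<comment> \<open>The piecewise constant coefficient is split as \<alpha> 2 everywhere plus the
      difference on the first subdomain, a sum of two functions already known to be
      integrable.\<close>
    have "integrable lebesgue (\<lambda>x. \<alpha> 2 * (indicator core x *\<^sub>R ?g x) +
        (\<alpha> 1 - \<alpha> 2) * (indicator (subdom M 1 \<inter> core) x *\<^sub>R ?g x))"
      using gc g1 unfolding set_integrable_def by (intro Bochner_Integration.integrable_add integrable_mult_right)
    also have "(\<lambda>x. \<alpha> 2 * (indicator core x *\<^sub>R ?g x) +
        (\<alpha> 1 - \<alpha> 2) * (indicator (subdom M 1 \<inter> core) x *\<^sub>R ?g x)) =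
        (\<lambda>x. indicator core x *\<^sub>R (a x * ?g x))"
      by (auto simp: a_def indicator_def algebra_simps)
    finally show ?thesis by (simp add: set_integrable_def)
  qed
  note ac = this
  have int: "interior \<Omega> \<inter> core = core" using core_subset open_domain by (auto simp: interior_open)
  have "diffusion_ip \<Omega> \<alpha> M u u = (LINT x:interior \<Omega> \<inter> core|lebesgue. a x * ?g x)"
    unfolding diffusion_ip_def
  proof (rule set_integral_core)
    show "\<Omega> \<subseteq> closure \<Omega>" by (rule closure_subset)
    show "\<Omega> \<inter> core \<subseteq> interior \<Omega>" using open_domain by (auto simp: interior_open)
    show "set_integrable lebesgue (interior \<Omega> \<inter> core) (\<lambda>x. a x * ?g x)" unfolding int by (rule ac)
    show "(if x \<in> subdom M 1 then \<alpha> 1 else \<alpha> 2) * (grad_on \<Omega> u x \<bullet> grad_on \<Omega> u x) = a x * ?g x"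
      if "x \<in> interior \<Omega> \<inter> core" for x
      using grad_on_core[OF that u refl] by (simp add: a_def gdot_def)
  qed
  then have D: "diffusion_ip \<Omega> \<alpha> M u u = (LINT x:core|lebesgue. a x * ?g x)" unfolding int .
  have "(LINT x:core|lebesgue. min (\<alpha> 1) (\<alpha> 2) * ?g x) \<le> (LINT x:core|lebesgue. a x * ?g x)"
    using gc ac g0 by (intro set_integral_mono set_integrable_mult_right mult_right_mono) (auto simp: a_def)
  then show "min (\<alpha> 1) (\<alpha> 2) * grad_ip \<Omega> u u \<le> diffusion_ip \<Omega> \<alpha> M u u"
    by (simp add: D grad_ip_domain u)
  have "(LINT x:core|lebesgue. a x * ?g x) \<le> (LINT x:core|lebesgue. max (\<alpha> 1) (\<alpha> 2) * ?g x)"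
    using gc ac g0 by (intro set_integral_mono set_integrable_mult_right mult_right_mono) (auto simp: a_def)
  then show "diffusion_ip \<Omega> \<alpha> M u u \<le> max (\<alpha> 1) (\<alpha> 2) * grad_ip \<Omega> u u"
    by (simp add: D grad_ip_domain u)
qed

end

text \<open>\<Omega> is the interior of a closed set, a finite union of polytopes, and interiors of
  closed sets are regular open.\<close>

lemma polygonal_domain_regular_open:
  assumes "polygonal_domain \<Omega>"
  shows "interior (closure \<Omega>) = \<Omega>"
proof -
  obtain \<P> where P: "finite \<P>" "\<And>K. K \<in> \<P> \<Longrightarrow> polytope K" "\<Omega> = interior (\<Union>\<P>)"
    using assms by (auto simp: polygonal_domain_def)
  have "closed (\<Union>\<P>)" using P(1,2) by (intro closed_Union) (auto intro: polytope_imp_closed)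
  then have "closure \<Omega> \<subseteq> \<Union>\<P>" unfolding P(3) using interior_subset by (intro closure_minimal) 
  then have "interior (closure \<Omega>) \<subseteq> \<Omega>" unfolding P(3) by (rule interior_mono)
  moreover have "open \<Omega>" using P(3) by simp
  ultimately show ?thesis using interior_maximal[OF closure_subset] by blast
qed

section \<open>Composition of uniform equivalences and the result\<close>

lemma unif_equiv_trans:
  assumes "unif_equiv S A B" "unif_equiv S B C"
  shows "unif_equiv S A C"
proof -
  obtain c1 c2 where c: "c1 > 0" "c2 > 0" "\<And>p. p \<in> S \<Longrightarrow> c1 * B p \<le> A p \<and> A p \<le> c2 * B p"
    using assms(1) unfolding unif_equiv_def by blast
  obtain d1 d2 where d: "d1 > 0" "d2 > 0" "\<And>p. p \<in> S \<Longrightarrow> d1 * C p \<le> B p \<and> B p \<le> d2 * C p"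
    using assms(2) unfolding unif_equiv_def by blast
  have "c1 * d1 * C p \<le> A p \<and> A p \<le> c2 * d2 * C p" if p: "p \<in> S" for p
  proof -
    have "c1 * (d1 * C p) \<le> c1 * B p" "c2 * B p \<le> c2 * (d2 * C p)"
      using c(1,2) d(3)[OF p] by (auto intro: mult_left_mono)
    then show ?thesis using c(3)[OF p] by (simp add: mult.assoc)
  qed
  then show ?thesis
    unfolding unif_equiv_def using c(1,2) d(1,2) by (intro exI[of _ "c1 * d1"] exI[of _ "c2 * d2"]) simp
qed

lemma unif_equiv_sym:
  assumes "unif_equiv S A B"
  shows "unif_equiv S B A"
proof -
  obtain c1 c2 where c: "c1 > 0" "c2 > 0" "\<And>p. p \<in> S \<Longrightarrow> c1 * B p \<le> A p \<and> A p \<le> c2 * B p"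
    using assms(1) unfolding unif_equiv_def by blast
  have "1 / c2 * A p \<le> B p \<and> B p \<le> 1 / c1 * A p" if p: "p \<in> S" for p
    using c(3)[OF p] c(1,2) by (simp add: field_simps)
  then show ?thesis
    unfolding unif_equiv_def using c(1,2) by (intro exI[of _ "1 / c2"] exI[of _ "1 / c1"]) simp
qed

theorem mainTheorem3:
  fixes \<Omega> :: "'a::euclidean_space set"
    and k :: nat
    and P :: "'p set"
    and M :: "'p \<Rightarrow> 'a cut_config"
    and \<alpha> :: "nat \<Rightarrow> real"
    and \<alpha>bar \<gamma> \<beta> :: real
  assumes "DIM('a) = 2 \<or> DIM('a) = 3"
    and "k \<ge> 1"
    and "polygonal_domain \<Omega>"
    and "\<forall>p\<in>P. partition_of \<Omega> (M p) \<and> smooth_interface \<Omega> (M p)"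
    and "\<forall>p\<in>P. mesh_of \<Omega> (mesh (M p))"
    and "\<exists>\<sigma>>0. \<forall>p\<in>P. shape_regular \<sigma> (mesh (M p))"
    and "\<forall>p\<in>P. nodal_basis k \<Omega> (M p)"
    and "\<forall>p\<in>P. I0 k \<Omega> (M p) \<inter> interface (M p) = {}"
    and "\<forall>p\<in>P. averaging_weights (M p) \<and> ghost_faces (M p)"
    and "\<alpha> 1 > 0" and "\<alpha> 2 > 0"
    and "min (\<alpha> 1) (\<alpha> 2) \<le> \<alpha>bar" and "\<alpha>bar \<le> max (\<alpha> 1) (\<alpha> 2)"
    and "\<gamma> > 0" and "\<beta> > 0"
    and norm_equivalence:
      "unif_equiv (SIGMA p:P. Vh k \<Omega> (M p) \<times> Vcut k \<Omega> (M p))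
         (\<lambda>(p, u). Ahat k \<Omega> \<alpha> \<alpha>bar \<gamma> \<beta> (M p) u u)
         (\<lambda>(p, u). energy k \<Omega> (M p) u)"
  shows "unif_equiv (P \<times> UNIV)
           (\<lambda>(p, x). quad_form (I0 k \<Omega> (M p)) (A0 k \<Omega> \<alpha> \<alpha>bar \<gamma> \<beta> (M p)) x)
           (\<lambda>(p, x). grad_ip \<Omega> (fe_fun k \<Omega> (M p) x) (fe_fun k \<Omega> (M p) x)) \<and>
         (\<forall>B :: 'p \<Rightarrow> 'a \<Rightarrow> 'a \<Rightarrow> real.
            (\<forall>p\<in>P. spd (I0 k \<Omega> (M p)) (B p)) \<and>
            unif_equiv (P \<times> UNIV)
              (\<lambda>(p, x). quad_form (I0 k \<Omega> (M p)) (B p) x)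
              (\<lambda>(p, x). diffusion_ip \<Omega> \<alpha> (M p) (fe_fun k \<Omega> (M p) x) (fe_fun k \<Omega> (M p) x))
            \<longrightarrow>
            unif_equiv (P \<times> UNIV)
              (\<lambda>(p, x). quad_form (I0 k \<Omega> (M p)) (B p) x)
              (\<lambda>(p, x). quad_form (I0 k \<Omega> (M p)) (A0 k \<Omega> \<alpha> \<alpha>bar \<gamma> \<beta> (M p)) x))"
proof -
  have mesh: "cut_mesh k \<Omega> (M p)" if "p \<in> P" for p
    using that assms(1,4,5,7,9) polygonal_domain_regular_open[OF assms(3)]
    by unfold_locales auto
  let ?A = "\<lambda>(p, x). quad_form (I0 k \<Omega> (M p)) (A0 k \<Omega> \<alpha> \<alpha>bar \<gamma> \<beta> (M p)) x"
  let ?E = "\<lambda>(p, x). energy k \<Omega> (M p) (fe_fun k \<Omega> (M p) x, \<lambda>_. 0)"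
  let ?G = "\<lambda>(p, x). grad_ip \<Omega> (fe_fun k \<Omega> (M p) x) (fe_fun k \<Omega> (M p) x)"
  let ?D = "\<lambda>(p, x). diffusion_ip \<Omega> \<alpha> (M p) (fe_fun k \<Omega> (M p) x) (fe_fun k \<Omega> (M p) x)"
  let ?S = "P \<times> (UNIV :: ('a \<Rightarrow> real) set)"
  obtain c1 c2 where c: "c1 > 0" "c2 > 0"
    and eq: "\<And>p u. p \<in> P \<Longrightarrow> u \<in> Vh k \<Omega> (M p) \<times> Vcut k \<Omega> (M p) \<Longrightarrow>
      c1 * energy k \<Omega> (M p) u \<le> Ahat k \<Omega> \<alpha> \<alpha>bar \<gamma> \<beta> (M p) u u \<and>
      Ahat k \<Omega> \<alpha> \<alpha>bar \<gamma> \<beta> (M p) u u \<le> c2 * energy k \<Omega> (M p) u"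
    using norm_equivalence unfolding unif_equiv_def Ball_def by (auto simp: mem_Sigma_iff)
  have "c1 * ?E q \<le> ?A q \<and> ?A q \<le> c2 * ?E q" if qS: "q \<in> ?S" for q
  proof -
    obtain p x where q: "q = (p, x)" "p \<in> P" using qS by auto
    interpret cut_mesh k \<Omega> "M p" by (rule mesh[OF q(2)])
    \<comment> \<open>The norm equivalence is used at the pair (u, 0), with u the finite element
      function of the vector \<open>x\<close>.\<close>
    show ?thesis
      using eq[OF q(2), of "(fe_fun k \<Omega> (M p) x, \<lambda>_. 0)"] fe_fun_Vh zero_in_Vcut
      by (simp add: q(1) quad_form_A0)
  qed
  then have AE: "unif_equiv ?S ?A ?E" unfolding unif_equiv_def using c by blast
  have "1 * ?G q \<le> ?E q \<and> ?E q \<le> 2 * ?G q" if qS: "q \<in> ?S" for q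
  proof -
    obtain p x where q: "q = (p, x)" "p \<in> P" using qS by auto
    interpret cut_mesh k \<Omega> "M p" by (rule mesh[OF q(2)])
    show ?thesis using energy_equiv_grad_ip[OF fe_fun_Vh, of x] by (simp add: q(1))
  qed
  then have EG: "unif_equiv ?S ?E ?G"
    unfolding unif_equiv_def by (intro exI[of _ 1] exI[of _ 2]) simp
  have "min (\<alpha> 1) (\<alpha> 2) * ?G q \<le> ?D q \<and> ?D q \<le> max (\<alpha> 1) (\<alpha> 2) * ?G q" if qS: "q \<in> ?S" for q
  proof -
    obtain p x where q: "q = (p, x)" "p \<in> P" using qS by auto
    interpret cut_mesh k \<Omega> "M p" by (rule mesh[OF q(2)])
    show ?thesis using diffusion_equiv_grad_ip[OF fe_fun_Vh, of \<alpha> x] by (simp add: q(1))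
  qed
  then have DG: "unif_equiv ?S ?D ?G"
    unfolding unif_equiv_def using assms(10,11)
    by (intro exI[of _ "min (\<alpha> 1) (\<alpha> 2)"] exI[of _ "max (\<alpha> 1) (\<alpha> 2)"]) simp
  have AG: "unif_equiv ?S ?A ?G" by (rule unif_equiv_trans[OF AE EG])
  \<comment> \<open>Composing the assumed equivalence of \<open>B\<close> with the diffusion form
    and this one gives the claim on \<open>B\<close>.\<close>
  have DA: "unif_equiv ?S ?D ?A" by (rule unif_equiv_trans[OF DG unif_equiv_sym[OF AG]])
  show ?thesis
    using AG unif_equiv_trans[OF _ DA] by blast
qed

end
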